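(* Let $f: A\to B$ and $g: A\to C$ be two ring homomorphisms and let $J$ and $J'$ be proper ideals of $B$ and $C$, respectively, such that $I_{o}:=f^{-1}(J)=g^{-1}(J')$. Let $A\bowtie^{f,g}(J,J')$ denote the bi-amalgamation of $A$ with $(B,C)$ along $(J,J')$ with respect to $(f,g)$. Then: (1) $A\bowtie^{f,g}(J,J')$ is a chained ring if and only if both $f(A)+J$ and $g(A)+J'$ are chained rings and ($J=0$ or $J'=0$). (2) $A\bowtie^{f,g}(J,J')$ is arithmetical if and only if both $f(A)+J$ and $g(A)+J'$ are arithmetical and, for every $\mathfrak{m}\in\operatorname{Max}(A,I_{o})$, $J_{S_{\mathfrak{m}}}=0$ or $J'_{S'_{\mathfrak{m}}}=0$.
   Context: All rings are commutative with unity. The bi-amalgamation is the subring of $B\times C$ given by $A\bowtie^{f,g}(J,J'):=\{(f(a)+j,\,g(a)+j')\mid a\in A,\ (j,j')\in J\times J'\}$. Here $f(A)+J$ and $g(A)+J'$ are regarded as subrings of $B$ and $C$, respectively. A ring $R$ is arithmetical if every finitely generated ideal of $R$ is locally principal. A chained ring is a local arithmetical ring, i.e., a ring whose lattice of ideals is totally ordered by inclusion. $\operatorname{Max}(A,I_{o})$ is the set of maximal ideals of $A$ containing $I_{o}$. For $\mathfrak{m}\in\operatorname{Max}(A,I_{o})$, $S_{\mathfrak{m}}:=f(A\setminus\mathfrak{m})+J=\{f(s)+j\mid s\in A\setminus\mathfrak{m},\ j\in J\}$ and $S'_{\mathfrak{m}}:=g(A\setminus\mathfrak{m})+J'=\{g(s)+j'\mid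 s\in A\setminus\mathfrak{m},\ j'\in J'\}$, which are multiplicative subsets of $B$ and $C$, respectively; $J_{S_{\mathfrak{m}}}$ denotes the localization $S_{\mathfrak{m}}^{-1}J$ (an ideal of $B_{S_{\mathfrak{m}}}=S_{\mathfrak{m}}^{-1}B$) and $J'_{S'_{\mathfrak{m}}}$ denotes $S_{\mathfrak{m}}'^{-1}J'$ (an ideal of $C_{S'_{\mathfrak{m}}}=S_{\mathfrak{m}}'^{-1}C$). *)

theory Defs
  imports "HOL-Algebra.Algebra"
begin

section \<open>Localization at a multiplicative subset\<close>

text \<open>
  The multiplicative subsets of a commutative ring \<open>R\<close> are the submonoids of its multiplicative
  monoid. Elements of \<open>S\<inverse>R\<close> are equivalence classes of pairs, \<open>(r, s)\<close> standing for \<open>r / s\<close>.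
\<close>

definition loc_rel :: "('a, 'm) ring_scheme \<Rightarrow> 'a set \<Rightarrow> (('a \<times> 'a) \<times> ('a \<times> 'a)) set" where
  "loc_rel R S = {((r, s), (r', s')). r \<in> carrier R \<and> s \<in> S \<and> r' \<in> carrier R \<and> s' \<in> S \<and>
     (\<exists>t\<in>S. t \<otimes>\<^bsub>R\<^esub> (s' \<otimes>\<^bsub>R\<^esub> r \<ominus>\<^bsub>R\<^esub> s \<otimes>\<^bsub>R\<^esub> r') = \<zero>\<^bsub>R\<^esub>)}"

definition loc_frac :: "('a, 'm) ring_scheme \<Rightarrow> 'a set \<Rightarrow> 'a \<Rightarrow> 'a \<Rightarrow> ('a \<times> 'a) set" where
  "loc_frac R S r s = loc_rel R S `` {(r, s)}"

text \<open>
  The unions below range over all representatives of the two classes; by independence of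
  representatives (\<open>loc_mult_frac\<close>, \<open>loc_add_frac\<close>) they are unions of equal sets.
\<close>

definition localization :: "('a, 'm) ring_scheme \<Rightarrow> 'a set \<Rightarrow> ('a \<times> 'a) set ring" where
  "localization R S =
    \<lparr>carrier = {loc_frac R S r s | r s. r \<in> carrier R \<and> s \<in> S},
     monoid.mult = (\<lambda>U V. \<Union>(r, s)\<in>U. \<Union>(r', s')\<in>V. loc_frac R S (r \<otimes>\<^bsub>R\<^esub> r') (s \<otimes>\<^bsub>R\<^esub> s')),
     one = loc_frac R S \<one>\<^bsub>R\<^esub> \<one>\<^bsub>R\<^esub>,
     ring.zero = loc_frac R S \<zero>\<^bsub>R\<^esub> \<one>\<^bsub>R\<^esub>,
     ring.add = (\<lambda>U V. \<Union>(r, s)\<in>U. \<Union>(r', s')\<in>V.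
       loc_frac R S (s' \<otimes>\<^bsub>R\<^esub> r \<oplus>\<^bsub>R\<^esub> s \<otimes>\<^bsub>R\<^esub> r') (s \<otimes>\<^bsub>R\<^esub> s'))\<rparr>"

text \<open>\<open>S\<inverse>I\<close>, as an ideal of \<open>S\<inverse>R\<close>.\<close>

definition loc_ideal :: "('a, 'm) ring_scheme \<Rightarrow> 'a set \<Rightarrow> 'a set \<Rightarrow> ('a \<times> 'a) set set" where
  "loc_ideal R S I = {loc_frac R S r s | r s. r \<in> I \<and> s \<in> S}"

locale mult_subset = cring R + submonoid S R for R (structure) and S
begin

lemma S_carr: "s \<in> S \<Longrightarrow> s \<in> carrier R"
  using subset by blast

lemma loc_rel_iff:
  assumes "r \<in> carrier R" "s \<in> S" "r' \<in> carrier R" "s' \<in> S"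
  shows "((r, s), (r', s')) \<in> loc_rel R S \<longleftrightarrow> (\<exists>t\<in>S. t \<otimes> (s' \<otimes> r) = t \<otimes> (s \<otimes> r'))"
proof -
  have "t \<otimes> (s' \<otimes> r \<ominus> s \<otimes> r') = \<zero> \<longleftrightarrow> t \<otimes> (s' \<otimes> r) = t \<otimes> (s \<otimes> r')" if "t \<in> S" for t
  proof -
    have "t \<otimes> (s' \<otimes> r \<ominus> s \<otimes> r') = t \<otimes> (s' \<otimes> r) \<ominus> t \<otimes> (s \<otimes> r')"
      using assms that S_carr by (simp add: a_minus_def r_distr r_minus)
    then show ?thesis
      using assms that S_carr by (simp add: r_right_minus_eq)
  qed
  then show ?thesis
    using assms by (auto simp: loc_rel_def)
qed

lemma equiv_loc_rel: "equiv (carrier R \<times> S) (loc_rel R S)"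
proof (rule equivI)
  show "loc_rel R S \<subseteq> (carrier R \<times> S) \<times> (carrier R \<times> S)"
    by (auto simp: loc_rel_def)
  show "refl_on (carrier R \<times> S) (loc_rel R S)"
    by (rule refl_onI) (auto simp: loc_rel_iff S_carr)
  show "sym (loc_rel R S)"
  proof (rule symI, clarify)
    fix r s r' s'
    assume a: "((r, s), (r', s')) \<in> loc_rel R S"
    then have "r \<in> carrier R" "s \<in> S" "r' \<in> carrier R" "s' \<in> S" by (auto simp: loc_rel_def)
    with a show "((r', s'), (r, s)) \<in> loc_rel R S" by (metis loc_rel_iff)
  qed
  show "trans (loc_rel R S)"
  proof (rule transI, clarify)
    fix a s b t c u
    assume 1: "((a, s), (b, t)) \<in> loc_rel R S" and 2: "((b, t), (c, u)) \<in> loc_rel R S"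
    then have m: "a \<in> carrier R" "b \<in> carrier R" "c \<in> carrier R" "s \<in> S" "t \<in> S" "u \<in> S"
      by (auto simp: loc_rel_def)
    then have mc: "s \<in> carrier R" "t \<in> carrier R" "u \<in> carrier R" using S_carr by auto
    obtain p where p: "p \<in> S" "p \<otimes> (t \<otimes> a) = p \<otimes> (s \<otimes> b)"
      using 1 m by (auto simp: loc_rel_iff)
    obtain q where q: "q \<in> S" "q \<otimes> (u \<otimes> b) = q \<otimes> (t \<otimes> c)"
      using 2 m by (auto simp: loc_rel_iff)
    have pq: "p \<in> carrier R" "q \<in> carrier R" using p q S_carr by auto
    have "(p \<otimes> q \<otimes> t) \<otimes> (u \<otimes> a) = q \<otimes> u \<otimes> (p \<otimes> (t \<otimes> a))"
      using m mc pq by (simp add: m_ac)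
    also have "\<dots> = p \<otimes> s \<otimes> (q \<otimes> (u \<otimes> b))"
      using m mc pq by (simp add: p(2)) (simp add: m_ac)
    also have "\<dots> = (p \<otimes> q \<otimes> t) \<otimes> (s \<otimes> c)"
      using m mc pq by (simp add: q(2)) (simp add: m_ac)
    finally show "((a, s), (c, u)) \<in> loc_rel R S"
      using m p(1) q(1) by (subst loc_rel_iff) (auto intro!: bexI[of _ "p \<otimes> q \<otimes> t"])
  qed
qed

lemma loc_frac_eq_iff:
  assumes "r \<in> carrier R" "s \<in> S" "r' \<in> carrier R" "s' \<in> S"
  shows "loc_frac R S r s = loc_frac R S r' s' \<longleftrightarrow> (\<exists>t\<in>S. t \<otimes> (s' \<otimes> r) = t \<otimes> (s \<otimes> r'))"
proof -
  have "loc_frac R S r s = loc_frac R S r' s' \<longleftrightarrow> ((r, s), (r', s')) \<in> loc_rel R S"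
    unfolding loc_frac_def by (rule eq_equiv_class_iff[OF equiv_loc_rel]) (use assms in auto)
  then show ?thesis using assms by (simp add: loc_rel_iff)
qed

lemma mem_fracD:
  assumes "r \<in> carrier R" "s \<in> S" "(r', s') \<in> loc_frac R S r s"
  shows "r' \<in> carrier R" "s' \<in> S" "loc_frac R S r s = loc_frac R S r' s'"
proof -
  show "r' \<in> carrier R" "s' \<in> S" using assms by (auto simp: loc_frac_def loc_rel_def)
  then show "loc_frac R S r s = loc_frac R S r' s'"
    using assms by (subst loc_frac_eq_iff) (auto simp: loc_frac_def loc_rel_iff)
qed

lemma mem_frac_self: "r \<in> carrier R \<Longrightarrow> s \<in> S \<Longrightarrow> (r, s) \<in> loc_frac R S r s"
  unfolding loc_frac_def using equiv_class_self[OF equiv_loc_rel] by auto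

lemma UN_frac:
  assumes "r \<in> carrier R" "s \<in> S" "r' \<in> carrier R" "s' \<in> S"
    and "\<And>a u b v. a \<in> carrier R \<Longrightarrow> u \<in> S \<Longrightarrow> b \<in> carrier R \<Longrightarrow> v \<in> S \<Longrightarrow>
      loc_frac R S r s = loc_frac R S a u \<Longrightarrow> loc_frac R S r' s' = loc_frac R S b v \<Longrightarrow> F a u b v = F r s r' s'"
  shows "(\<Union>(a, u)\<in>loc_frac R S r s. \<Union>(b, v)\<in>loc_frac R S r' s'. F a u b v) = F r s r' s'"
proof -
  have "F a u b v = F r s r' s'" if "(a, u) \<in> loc_frac R S r s" "(b, v) \<in> loc_frac R S r' s'" for a u b v
    using assms mem_fracD that by metis
  moreover have "(r, s) \<in> loc_frac R S r s" "(r', s') \<in> loc_frac R S r' s'"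
    using assms mem_frac_self by auto
  ultimately show ?thesis by blast
qed

lemma loc_mult_frac:
  assumes "r \<in> carrier R" "s \<in> S" "r' \<in> carrier R" "s' \<in> S"
  shows "loc_frac R S r s \<otimes>\<^bsub>localization R S\<^esub> loc_frac R S r' s' = loc_frac R S (r \<otimes> r') (s \<otimes> s')"
  unfolding localization_def monoid.simps
proof (rule UN_frac[OF assms])
  fix a u b v
  assume h: "a \<in> carrier R" "u \<in> S" "b \<in> carrier R" "v \<in> S"
    "loc_frac R S r s = loc_frac R S a u" "loc_frac R S r' s' = loc_frac R S b v"
  obtain p where p: "p \<in> S" "p \<otimes> (u \<otimes> r) = p \<otimes> (s \<otimes> a)" using h assms by (auto simp: loc_frac_eq_iff)
  obtain q where q: "q \<in> S" "q \<otimes> (v \<otimes> r') = q \<otimes> (s' \<otimes> b)" using h assms by (auto simp: loc_frac_eq_iff)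
  have c: "s \<in> carrier R" "s' \<in> carrier R" "u \<in> carrier R" "v \<in> carrier R" "p \<in> carrier R" "q \<in> carrier R"
    using S_carr assms h p q by auto
  have "(p \<otimes> q) \<otimes> ((s \<otimes> s') \<otimes> (a \<otimes> b)) = (p \<otimes> (s \<otimes> a)) \<otimes> (q \<otimes> (s' \<otimes> b))"
    using assms h c by (simp add: m_ac)
  also have "\<dots> = (p \<otimes> (u \<otimes> r)) \<otimes> (q \<otimes> (v \<otimes> r'))" by (simp add: p q)
  also have "\<dots> = (p \<otimes> q) \<otimes> ((u \<otimes> v) \<otimes> (r \<otimes> r'))"
    using assms h c by (simp add: m_ac)
  finally show "loc_frac R S (a \<otimes> b) (u \<otimes> v) = loc_frac R S (r \<otimes> r') (s \<otimes> s')"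
    using assms h p q by (subst loc_frac_eq_iff) (auto intro!: bexI[of _ "p \<otimes> q"])
qed

lemma loc_add_frac:
  assumes "r \<in> carrier R" "s \<in> S" "r' \<in> carrier R" "s' \<in> S"
  shows "loc_frac R S r s \<oplus>\<^bsub>localization R S\<^esub> loc_frac R S r' s' =
    loc_frac R S (s' \<otimes> r \<oplus> s \<otimes> r') (s \<otimes> s')"
  unfolding localization_def ring.simps
proof (rule UN_frac[OF assms])
  fix a u b v
  assume h: "a \<in> carrier R" "u \<in> S" "b \<in> carrier R" "v \<in> S"
    "loc_frac R S r s = loc_frac R S a u" "loc_frac R S r' s' = loc_frac R S b v"
  obtain p where p: "p \<in> S" "p \<otimes> (u \<otimes> r) = p \<otimes> (s \<otimes> a)" using h assms by (auto simp: loc_frac_eq_iff)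
  obtain q where q: "q \<in> S" "q \<otimes> (v \<otimes> r') = q \<otimes> (s' \<otimes> b)" using h assms by (auto simp: loc_frac_eq_iff)
  have c: "s \<in> carrier R" "s' \<in> carrier R" "u \<in> carrier R" "v \<in> carrier R" "p \<in> carrier R" "q \<in> carrier R"
    using S_carr assms h p q by auto
  have "(p \<otimes> q) \<otimes> ((s \<otimes> s') \<otimes> (v \<otimes> a \<oplus> u \<otimes> b)) =
      (q \<otimes> s' \<otimes> v) \<otimes> (p \<otimes> (s \<otimes> a)) \<oplus> (p \<otimes> s \<otimes> u) \<otimes> (q \<otimes> (s' \<otimes> b))"
    using assms h c by (simp add: r_distr m_ac)
  also have "\<dots> = (q \<otimes> s' \<otimes> v) \<otimes> (p \<otimes> (u \<otimes> r)) \<oplus> (p \<otimes> s \<otimes> u) \<otimes> (q \<otimes> (v \<otimes> r'))"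
    by (simp add: p q)
  also have "\<dots> = (p \<otimes> q) \<otimes> ((u \<otimes> v) \<otimes> (s' \<otimes> r \<oplus> s \<otimes> r'))"
    using assms h c by (simp add: r_distr m_ac)
  finally show "loc_frac R S (v \<otimes> a \<oplus> u \<otimes> b) (u \<otimes> v) = loc_frac R S (s' \<otimes> r \<oplus> s \<otimes> r') (s \<otimes> s')"
    using assms h p q c by (subst loc_frac_eq_iff) (auto intro!: bexI[of _ "p \<otimes> q"])
qed

lemma frac_cong:
  assumes "r \<in> carrier R" "s \<in> S" "r' \<in> carrier R" "s' \<in> S" "s' \<otimes> r = s \<otimes> r'"
  shows "loc_frac R S r s = loc_frac R S r' s'"
  using assms by (subst loc_frac_eq_iff) auto

lemma loc_cases:
  assumes "x \<in> carrier (localization R S)"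
  obtains r s where "r \<in> carrier R" "s \<in> S" "s \<in> carrier R" "x = loc_frac R S r s"
  using assms S_carr by (auto simp: localization_def)

lemma loc_carrier: "carrier (localization R S) = {loc_frac R S r s | r s. r \<in> carrier R \<and> s \<in> S}"
  and loc_one: "\<one>\<^bsub>localization R S\<^esub> = loc_frac R S \<one> \<one>"
  and loc_zero: "\<zero>\<^bsub>localization R S\<^esub> = loc_frac R S \<zero> \<one>"
  by (simp_all add: localization_def)

lemma frac_closed: "r \<in> carrier R \<Longrightarrow> s \<in> S \<Longrightarrow> loc_frac R S r s \<in> carrier (localization R S)"
  by (auto simp: loc_carrier)

lemma cring_localization: "cring (localization R S)"
proof (rule cringI)
  show "abelian_group (localization R S)"
  proof (rule abelian_groupI)
    fix x y z
    assume "x \<in> carrier (localization R S)" "y \<in> carrier (localization R S)" "z \<in> carrier (localization R S)"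
    obtain a s where e1: "a \<in> carrier R" "s \<in> S" "s \<in> carrier R" "x = loc_frac R S a s"
      using \<open>x \<in> carrier (localization R S)\<close> by (rule loc_cases)
    obtain b t where e2: "b \<in> carrier R" "t \<in> S" "t \<in> carrier R" "y = loc_frac R S b t"
      using \<open>y \<in> carrier (localization R S)\<close> by (rule loc_cases)
    obtain c u where e3: "c \<in> carrier R" "u \<in> S" "u \<in> carrier R" "z = loc_frac R S c u"
      using \<open>z \<in> carrier (localization R S)\<close> by (rule loc_cases)
    note e = e1 e2 e3
    from e show "(x \<oplus>\<^bsub>localization R S\<^esub> y) \<oplus>\<^bsub>localization R S\<^esub> z =
        x \<oplus>\<^bsub>localization R S\<^esub> (y \<oplus>\<^bsub>localization R S\<^esub> z)"
      by (simp add: loc_add_frac r_distr m_ac a_ac)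
  next
    fix x y
    assume "x \<in> carrier (localization R S)" "y \<in> carrier (localization R S)"
    obtain a s where e1: "a \<in> carrier R" "s \<in> S" "s \<in> carrier R" "x = loc_frac R S a s"
      using \<open>x \<in> carrier (localization R S)\<close> by (rule loc_cases)
    obtain b t where e2: "b \<in> carrier R" "t \<in> S" "t \<in> carrier R" "y = loc_frac R S b t"
      using \<open>y \<in> carrier (localization R S)\<close> by (rule loc_cases)
    note e = e1 e2
    from e show "x \<oplus>\<^bsub>localization R S\<^esub> y \<in> carrier (localization R S)"
      by (simp add: loc_add_frac frac_closed)
    from e show "x \<oplus>\<^bsub>localization R S\<^esub> y = y \<oplus>\<^bsub>localization R S\<^esub> x"
      by (simp add: loc_add_frac m_ac a_ac)
  next
    show "\<zero>\<^bsub>localization R S\<^esub> \<in> carrier (localization R S)"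
      by (simp add: loc_zero frac_closed)
  next
    fix x assume "x \<in> carrier (localization R S)"
    then obtain a s where e: "a \<in> carrier R" "s \<in> S" "s \<in> carrier R" "x = loc_frac R S a s"
      by (rule loc_cases)
    then show "\<zero>\<^bsub>localization R S\<^esub> \<oplus>\<^bsub>localization R S\<^esub> x = x"
      by (simp add: loc_zero loc_add_frac)
    have "s \<otimes> \<ominus> a \<oplus> s \<otimes> a = \<zero>"
      using e by (simp add: r_distr[symmetric] l_neg)
    then have "loc_frac R S (\<ominus> a) s \<oplus>\<^bsub>localization R S\<^esub> x = loc_frac R S \<zero> (s \<otimes> s)"
      using e by (simp add: loc_add_frac)
    also have "\<dots> = \<zero>\<^bsub>localization R S\<^esub>"
      unfolding loc_zero using e by (intro frac_cong) auto
    finally have "loc_frac R S (\<ominus> a) s \<oplus>\<^bsub>localization R S\<^esub> x = \<zero>\<^bsub>localization R S\<^esub>" .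
    then show "\<exists>y\<in>carrier (localization R S). y \<oplus>\<^bsub>localization R S\<^esub> x = \<zero>\<^bsub>localization R S\<^esub>"
      using e frac_closed by (intro bexI[of _ "loc_frac R S (\<ominus> a) s"]) auto
  qed
next
  show "comm_monoid (localization R S)"
  proof (rule comm_monoidI)
    fix x y z
    assume "x \<in> carrier (localization R S)" "y \<in> carrier (localization R S)" "z \<in> carrier (localization R S)"
    obtain a s where e1: "a \<in> carrier R" "s \<in> S" "s \<in> carrier R" "x = loc_frac R S a s"
      using \<open>x \<in> carrier (localization R S)\<close> by (rule loc_cases)
    obtain b t where e2: "b \<in> carrier R" "t \<in> S" "t \<in> carrier R" "y = loc_frac R S b t"
      using \<open>y \<in> carrier (localization R S)\<close> by (rule loc_cases)
    obtain c u where e3: "c \<in> carrier R" "u \<in> S" "u \<in> carrier R" "z = loc_frac R S c u"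
      using \<open>z \<in> carrier (localization R S)\<close> by (rule loc_cases)
    note e = e1 e2 e3
    from e show "(x \<otimes>\<^bsub>localization R S\<^esub> y) \<otimes>\<^bsub>localization R S\<^esub> z =
        x \<otimes>\<^bsub>localization R S\<^esub> (y \<otimes>\<^bsub>localization R S\<^esub> z)"
      by (simp add: loc_mult_frac m_ac)
  next
    fix x y
    assume "x \<in> carrier (localization R S)" "y \<in> carrier (localization R S)"
    obtain a s where e1: "a \<in> carrier R" "s \<in> S" "s \<in> carrier R" "x = loc_frac R S a s"
      using \<open>x \<in> carrier (localization R S)\<close> by (rule loc_cases)
    obtain b t where e2: "b \<in> carrier R" "t \<in> S" "t \<in> carrier R" "y = loc_frac R S b t"
      using \<open>y \<in> carrier (localization R S)\<close> by (rule loc_cases)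
    note e = e1 e2
    from e show "x \<otimes>\<^bsub>localization R S\<^esub> y \<in> carrier (localization R S)"
      by (simp add: loc_mult_frac frac_closed)
    from e show "x \<otimes>\<^bsub>localization R S\<^esub> y = y \<otimes>\<^bsub>localization R S\<^esub> x"
      by (simp add: loc_mult_frac m_ac)
  next
    show "\<one>\<^bsub>localization R S\<^esub> \<in> carrier (localization R S)"
      by (simp add: loc_one frac_closed)
  next
    fix x assume "x \<in> carrier (localization R S)"
    then show "\<one>\<^bsub>localization R S\<^esub> \<otimes>\<^bsub>localization R S\<^esub> x = x"
      by (rule loc_cases) (simp add: loc_one loc_mult_frac)
  qed
next
  fix x y z
  assume "x \<in> carrier (localization R S)" "y \<in> carrier (localization R S)" "z \<in> carrier (localization R S)"
  obtain a s where e1: "a \<in> carrier R" "s \<in> S" "s \<in> carrier R" "x = loc_frac R S a s"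
    using \<open>x \<in> carrier (localization R S)\<close> by (rule loc_cases)
  obtain b t where e2: "b \<in> carrier R" "t \<in> S" "t \<in> carrier R" "y = loc_frac R S b t"
    using \<open>y \<in> carrier (localization R S)\<close> by (rule loc_cases)
  obtain c u where e3: "c \<in> carrier R" "u \<in> S" "u \<in> carrier R" "z = loc_frac R S c u"
    using \<open>z \<in> carrier (localization R S)\<close> by (rule loc_cases)
  note e = e1 e2 e3
  show "(x \<oplus>\<^bsub>localization R S\<^esub> y) \<otimes>\<^bsub>localization R S\<^esub> z =
      x \<otimes>\<^bsub>localization R S\<^esub> z \<oplus>\<^bsub>localization R S\<^esub> y \<otimes>\<^bsub>localization R S\<^esub> z"
    using e by (simp add: loc_add_frac loc_mult_frac) (rule frac_cong, auto simp: r_distr l_distr m_ac)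
qed

lemma ideal_loc_ideal:
  assumes "ideal I R"
  shows "ideal (loc_ideal R S I) (localization R S)"
proof -
  interpret I: ideal I R by fact
  interpret L: cring "localization R S" by (rule cring_localization)
  have mult: "x \<otimes>\<^bsub>localization R S\<^esub> y \<in> loc_ideal R S I"
    if x: "x \<in> carrier (localization R S)" and y: "y \<in> loc_ideal R S I" for x y
  proof -
    obtain a s where "a \<in> carrier R" "s \<in> S" "s \<in> carrier R" "x = loc_frac R S a s"
      using x by (rule loc_cases)
    moreover obtain b t where "b \<in> I" "t \<in> S" "y = loc_frac R S b t"
      using y by (auto simp: loc_ideal_def)
    ultimately show ?thesis
      using I.I_l_closed I.Icarr by (auto simp: loc_mult_frac loc_ideal_def)
  qed
  have sub: "loc_ideal R S I \<subseteq> carrier (localization R S)"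
    using I.Icarr frac_closed by (auto simp: loc_ideal_def)
  have "subgroup (loc_ideal R S I) (add_monoid (localization R S))"
  proof (rule L.add.subgroupI)
    show "loc_ideal R S I \<subseteq> carrier (localization R S)" by (rule sub)
    show "loc_ideal R S I \<noteq> {}"
      using I.zero_closed one_closed unfolding loc_ideal_def by blast
  next
    fix x assume x: "x \<in> loc_ideal R S I"
    have "\<ominus>\<^bsub>localization R S\<^esub> x = (\<ominus>\<^bsub>localization R S\<^esub> \<one>\<^bsub>localization R S\<^esub>) \<otimes>\<^bsub>localization R S\<^esub> x"
      using x sub by (subst L.l_minus) auto
    then show "\<ominus>\<^bsub>localization R S\<^esub> x \<in> loc_ideal R S I" using mult x by simp
  next
    fix x y assume "x \<in> loc_ideal R S I" "y \<in> loc_ideal R S I"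
    then obtain a s b t where "a \<in> I" "s \<in> S" "x = loc_frac R S a s" "b \<in> I" "t \<in> S" "y = loc_frac R S b t"
      unfolding loc_ideal_def by blast
    moreover from this have "t \<otimes> a \<oplus> s \<otimes> b \<in> I" using S_carr I.I_l_closed by auto
    ultimately show "x \<oplus>\<^bsub>localization R S\<^esub> y \<in> loc_ideal R S I"
      using I.Icarr by (auto simp: loc_add_frac loc_ideal_def)
  qed
  moreover have "y \<otimes>\<^bsub>localization R S\<^esub> x \<in> loc_ideal R S I"
    if "x \<in> carrier (localization R S)" "y \<in> loc_ideal R S I" for x y
    using mult[OF that] L.m_comm[OF that(1) subsetD[OF sub that(2)]] by simp
  ultimately show ?thesis
    using mult by (intro idealI L.ring_axioms)
qed

end

lemma (in primeideal) mult_subset_compl: "mult_subset R (carrier R - I)"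
proof unfold_locales
  show "\<one> \<in> carrier R - I" using I_notcarr one_imp_carrier by auto
  show "x \<otimes> y \<in> carrier R - I" if "x \<in> carrier R - I" "y \<in> carrier R - I" for x y
    using that I_prime by auto
qed auto


section \<open>Arithmetical and chained rings\<close>

definition fg_ideal :: "('a, 'm) ring_scheme \<Rightarrow> 'a set \<Rightarrow> bool" where
  "fg_ideal R I \<longleftrightarrow> (\<exists>T. finite T \<and> T \<subseteq> carrier R \<and> I = Idl\<^bsub>R\<^esub> T)"

definition locally_principal :: "('a, 'm) ring_scheme \<Rightarrow> 'a set \<Rightarrow> bool" where
  "locally_principal R I \<longleftrightarrow>
    (\<forall>M. maximalideal M R \<longrightarrow>
      principalideal (loc_ideal R (carrier R - M) I) (localization R (carrier R - M)))"

definition arithmetical_ring :: "('a, 'm) ring_scheme \<Rightarrow> bool" where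
  "arithmetical_ring R \<longleftrightarrow> cring R \<and> (\<forall>I. fg_ideal R I \<longrightarrow> locally_principal R I)"

definition local_ring :: "('a, 'm) ring_scheme \<Rightarrow> bool" where
  "local_ring R \<longleftrightarrow> cring R \<and> (\<exists>!M. maximalideal M R)"

text \<open>By a standard result, these are the nonzero commutative rings whose ideals are totally ordered by inclusion.\<close>

definition chained_ring :: "('a, 'm) ring_scheme \<Rightarrow> bool" where
  "chained_ring R \<longleftrightarrow> local_ring R \<and> arithmetical_ring R"


section \<open>Bi-amalgamations\<close>

definition image_plus_ideal ::
  "('a, 'm) ring_scheme \<Rightarrow> ('b, 'n) ring_scheme \<Rightarrow> ('a \<Rightarrow> 'b) \<Rightarrow> 'b set \<Rightarrow> ('b, 'n) ring_scheme" where
  "image_plus_ideal A B f J = B\<lparr>carrier := f ` carrier A <+>\<^bsub>B\<^esub> J\<rparr>"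

definition bi_amalgamation ::
  "('a, 'm) ring_scheme \<Rightarrow> ('b, 'n) ring_scheme \<Rightarrow> ('c, 'o) ring_scheme \<Rightarrow>
    ('a \<Rightarrow> 'b) \<Rightarrow> ('a \<Rightarrow> 'c) \<Rightarrow> 'b set \<Rightarrow> 'c set \<Rightarrow> ('b \<times> 'c) ring" where
  "bi_amalgamation A B C f g J J' = (RDirProd B C)
    \<lparr>carrier := {(f a \<oplus>\<^bsub>B\<^esub> j, g a \<oplus>\<^bsub>C\<^esub> j') | a j j'. a \<in> carrier A \<and> j \<in> J \<and> j' \<in> J'}\<rparr>"

definition Max_containing :: "('a, 'm) ring_scheme \<Rightarrow> 'a set \<Rightarrow> 'a set set" where
  "Max_containing A I = {M. maximalideal M A \<and> I \<subseteq> M}"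

definition S_at ::
  "('a, 'm) ring_scheme \<Rightarrow> ('b, 'n) ring_scheme \<Rightarrow> ('a \<Rightarrow> 'b) \<Rightarrow> 'b set \<Rightarrow> 'a set \<Rightarrow> 'b set" where
  "S_at A B f J M = f ` (carrier A - M) <+>\<^bsub>B\<^esub> J"

lemma sum_ideal_mult:
  assumes "cring B" "ideal J B" "x \<in> carrier B" "y \<in> carrier B" "j \<in> J" "k \<in> J"
  shows "\<exists>l\<in>J. (x \<oplus>\<^bsub>B\<^esub> j) \<otimes>\<^bsub>B\<^esub> (y \<oplus>\<^bsub>B\<^esub> k) = x \<otimes>\<^bsub>B\<^esub> y \<oplus>\<^bsub>B\<^esub> l"
proof -
  interpret B: cring B by fact
  interpret J: ideal J B by fact
  have c: "j \<in> carrier B" "k \<in> carrier B" using assms J.Icarr by auto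
  have "x \<otimes>\<^bsub>B\<^esub> k \<oplus>\<^bsub>B\<^esub> (j \<otimes>\<^bsub>B\<^esub> y \<oplus>\<^bsub>B\<^esub> j \<otimes>\<^bsub>B\<^esub> k) \<in> J"
    using assms c J.I_l_closed J.I_r_closed by auto
  then show ?thesis
    by (rule bexI[rotated]) (use assms c in \<open>simp add: B.l_distr B.r_distr B.a_ac\<close>)
qed

lemma subcring_image_plus_ideal:
  assumes "cring A" "cring B" "f \<in> ring_hom A B" "ideal J B"
  shows "subcring (f ` carrier A <+>\<^bsub>B\<^esub> J) B"
proof -
  interpret A: cring A by fact
  interpret B: cring B by fact
  interpret J: ideal J B by fact
  interpret f: ring_hom_cring A B f by unfold_locales fact
  have mem: "x \<in> f ` carrier A <+>\<^bsub>B\<^esub> J \<longleftrightarrow> (\<exists>a\<in>carrier A. \<exists>j\<in>J. x = f a \<oplus>\<^bsub>B\<^esub> j)" for x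
    by (auto simp: set_add_def')
  show ?thesis
  proof (rule B.subcringI'[OF B.subringI])
    show "f ` carrier A <+>\<^bsub>B\<^esub> J \<subseteq> carrier B"
      using J.Icarr by (auto simp: mem)
    have "\<one>\<^bsub>B\<^esub> = f \<one>\<^bsub>A\<^esub> \<oplus>\<^bsub>B\<^esub> \<zero>\<^bsub>B\<^esub>" by simp
    then show "\<one>\<^bsub>B\<^esub> \<in> f ` carrier A <+>\<^bsub>B\<^esub> J"
      unfolding mem using J.zero_closed by blast
  next
    fix h assume "h \<in> f ` carrier A <+>\<^bsub>B\<^esub> J"
    then obtain a j where h: "a \<in> carrier A" "j \<in> J" "h = f a \<oplus>\<^bsub>B\<^esub> j" unfolding mem by blast
    then have "\<ominus>\<^bsub>B\<^esub> h = f (\<ominus>\<^bsub>A\<^esub> a) \<oplus>\<^bsub>B\<^esub> (\<ominus>\<^bsub>B\<^esub> j)"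
      using J.Icarr by (simp add: B.minus_add)
    then show "\<ominus>\<^bsub>B\<^esub> h \<in> f ` carrier A <+>\<^bsub>B\<^esub> J"
      unfolding mem using h A.a_inv_closed J.a_inv_closed by blast
  next
    fix h k assume "h \<in> f ` carrier A <+>\<^bsub>B\<^esub> J" "k \<in> f ` carrier A <+>\<^bsub>B\<^esub> J"
    then obtain a j b i where h: "a \<in> carrier A" "j \<in> J" "h = f a \<oplus>\<^bsub>B\<^esub> j"
      and k: "b \<in> carrier A" "i \<in> J" "k = f b \<oplus>\<^bsub>B\<^esub> i" unfolding mem by blast
    have "h \<oplus>\<^bsub>B\<^esub> k = f (a \<oplus>\<^bsub>A\<^esub> b) \<oplus>\<^bsub>B\<^esub> (j \<oplus>\<^bsub>B\<^esub> i)"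
      using h k J.Icarr by (simp add: B.a_ac)
    then show "h \<oplus>\<^bsub>B\<^esub> k \<in> f ` carrier A <+>\<^bsub>B\<^esub> J"
      unfolding mem using h k A.a_closed J.a_closed by blast
    obtain l where "l \<in> J" "h \<otimes>\<^bsub>B\<^esub> k = f a \<otimes>\<^bsub>B\<^esub> f b \<oplus>\<^bsub>B\<^esub> l"
      using sum_ideal_mult[OF assms(2,4), of "f a" "f b" j i] h k by auto
    then have "h \<otimes>\<^bsub>B\<^esub> k = f (a \<otimes>\<^bsub>A\<^esub> b) \<oplus>\<^bsub>B\<^esub> l" using h k by simp
    then show "h \<otimes>\<^bsub>B\<^esub> k \<in> f ` carrier A <+>\<^bsub>B\<^esub> J"
      unfolding mem using \<open>l \<in> J\<close> h k A.m_closed by blast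
  qed
qed

lemma mult_subset_S_at:
  assumes "cring A" "cring B" "f \<in> ring_hom A B" "ideal J B" "primeideal M A"
  shows "mult_subset B (S_at A B f J M)"
proof -
  interpret A: cring A by fact
  interpret B: cring B by fact
  interpret J: ideal J B by fact
  interpret M: primeideal M A by fact
  interpret T: mult_subset A "carrier A - M" by (rule M.mult_subset_compl)
  have fc: "f a \<in> carrier B" if "a \<in> carrier A" for a using assms(3) that by (rule ring_hom_closed)
  show ?thesis
  proof unfold_locales
    show "S_at A B f J M \<subseteq> carrier B"
      using fc J.Icarr by (auto simp: S_at_def set_add_def')
    have "\<one>\<^bsub>B\<^esub> = f \<one>\<^bsub>A\<^esub> \<oplus>\<^bsub>B\<^esub> \<zero>\<^bsub>B\<^esub>" using assms(3) by (simp add: ring_hom_one)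
    then show "\<one>\<^bsub>B\<^esub> \<in> S_at A B f J M"
      using T.one_closed J.zero_closed by (fastforce simp: S_at_def set_add_def')
    fix x y assume "x \<in> S_at A B f J M" "y \<in> S_at A B f J M"
    then obtain s j t k where e: "s \<in> carrier A - M" "t \<in> carrier A - M" "j \<in> J" "k \<in> J"
      "x = f s \<oplus>\<^bsub>B\<^esub> j" "y = f t \<oplus>\<^bsub>B\<^esub> k"
      by (auto simp: S_at_def set_add_def')
    then obtain l where "l \<in> J" "x \<otimes>\<^bsub>B\<^esub> y = f s \<otimes>\<^bsub>B\<^esub> f t \<oplus>\<^bsub>B\<^esub> l"
      using sum_ideal_mult[OF assms(2,4), of "f s" "f t" j k] fc by auto
    moreover have "f s \<otimes>\<^bsub>B\<^esub> f t = f (s \<otimes>\<^bsub>A\<^esub> t)" using e assms(3) by (simp add: ring_hom_mult)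
    moreover have "s \<otimes>\<^bsub>A\<^esub> t \<in> carrier A - M" using e T.m_closed by blast
    ultimately show "x \<otimes>\<^bsub>B\<^esub> y \<in> S_at A B f J M"
      by (auto simp: S_at_def set_add_def')
  qed
qed

end

theory Submission
  imports Defs
begin

text \<open>
  A commutative ring is arithmetical iff any two elements \<open>a, b\<close> satisfy
  \<open>(bR : a) + (aR : b) = R\<close>: at a maximal ideal, a pair generates a principal ideal exactly when one
  of the two elements divides the other there, that is, when one of the two colon ideals escapes
  the maximal ideal (\<open>arithmetical_ring_iff_comparable\<close>). A ring is chained iff it is nonzero and
  divisibility is total on it (\<open>chained_ring_iff_divides_total\<close>). These criteria replace local
  principality by divisibility equations, which ring homomorphisms preserve.

  The bi-amalgamation \<open>D\<close> is a subdirect product of \<open>R = f(A) + J\<close> and \<open>S = g(A) + J'\<close>: the two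
  projections are onto, and their kernels \<open>0 \<times> J'\<close> and \<open>J \<times> 0\<close> meet in zero. Modulo the sum of
  the kernels, \<open>J \<times> J'\<close>, every element of \<open>D\<close> comes from \<open>A\<close>.

  If \<open>D\<close> is chained or arithmetical, then so are its images \<open>R\<close> and \<open>S\<close>. Elements \<open>k, l\<close> of the two
  kernels can only be compared trivially: \<open>u k \<in> D l\<close> forces \<open>u k\<close> into both kernels, so \<open>u k = 0\<close>.
  Hence in the chained case one of the kernels is zero, and in the arithmetical case the elements
  \<open>u\<close>, \<open>v\<close> with \<open>u + v = 1\<close>, \<open>u k = 0\<close>, \<open>v l = 0\<close> show that at each maximal ideal one of the
  kernels localizes to zero.

  Conversely, if one kernel is zero then \<open>D\<close> is isomorphic to one of its images, which settles the
  chained case. In the arithmetical case fix \<open>a, b \<in> D\<close> and let \<open>N = (bD : a) + (aD : b)\<close>. A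
  comparison of the images of \<open>a\<close> and \<open>b\<close> in \<open>R\<close> lifts to \<open>D\<close> up to two errors in the kernel of
  the projection to \<open>R\<close>, and \<open>N\<close> contains everything that annihilates both errors
  (\<open>comparison_of_kernel_annihilator\<close>). So \<open>N\<close> contains the other kernel and, by symmetry, both.
  If \<open>N\<close> were proper, its preimage in \<open>A\<close> would lie in a maximal ideal \<open>M\<close> containing \<open>I\<^sub>o\<close>, where
  one of the kernels is locally zero; then both errors are annihilated by some element
  \<open>(f s + j, g s + j')\<close> with \<open>s\<close> outside \<open>M\<close>. It lies in \<open>N\<close>, and so does \<open>(j, j')\<close>; hence \<open>s\<close> is
  in the preimage of \<open>N\<close>, which \<open>M\<close> contains, a contradiction.
\<close>


section \<open>Existence of maximal ideals\<close>

lemma (in cring) exists_maximalideal: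
  assumes I: "ideal I R" and proper: "I \<noteq> carrier R"
  shows "\<exists>M. maximalideal M R \<and> I \<subseteq> M"
proof -
  have one_iff: "\<one> \<notin> L \<longleftrightarrow> L \<noteq> carrier R" if "ideal L R" for L
    using ideal.one_imp_carrier[OF that] by auto
  \<comment> \<open>Excluding \<open>\<one>\<close> expresses properness in a form that passes to unions of chains.\<close>
  define F where "F = {L. ideal L R \<and> I \<subseteq> L \<and> \<one> \<notin> L}"
  have "\<exists>M\<in>F. \<forall>L\<in>F. M \<subseteq> L \<longrightarrow> L = M"
  proof (rule subset_Zorn)
    fix c assume c: "subset.chain F c"
    show "\<exists>U\<in>F. \<forall>L\<in>c. L \<subseteq> U"
    proof (cases "c = {}")
      case True
      have "I \<in> F" using I proper one_iff by (auto simp: F_def)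
      then show ?thesis using True by blast
    next
      case False
      have "subset.chain {L. ideal L R} c"
        using c by (auto simp: pred_on.chain_def F_def)
      then have "ideal (\<Union>c) R"
        using chain_Union_is_ideal[of c] False by simp
      moreover have "c \<subseteq> F" using c by (simp add: pred_on.chain_def)
      then have "I \<subseteq> \<Union>c" "\<one> \<notin> \<Union>c"
        using False by (auto simp: F_def)
      ultimately have "\<Union>c \<in> F" by (simp add: F_def)
      then show ?thesis by blast
    qed
  qed
  then obtain M where M: "M \<in> F" and max: "\<And>L. L \<in> F \<Longrightarrow> M \<subseteq> L \<Longrightarrow> L = M"
    by blast
  have "maximalideal M R"
  proof (rule maximalidealI)
    show "ideal M R" using M by (simp add: F_def)
    then show "carrier R \<noteq> M" using M one_iff by (auto simp: F_def)
    fix L assume L: "ideal L R" "M \<subseteq> L"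
    show "L = M \<or> L = carrier R"
      using max[of L] L M one_iff[OF L(1)] by (auto simp: F_def)
  qed
  then show ?thesis using M by (auto simp: F_def)
qed

section \<open>Ideals in localizations\<close>

text \<open>
  A fraction \<open>x / s\<close> is zero iff some element of \<open>S\<close> annihilates \<open>x\<close>. In this form the vanishing
  of a localized ideal can be transferred between a subdirect product and its factors.
\<close>

lemma (in mult_subset) loc_ideal_zero_iff:
  assumes I: "ideal I R"
  shows "loc_ideal R S I = {\<zero>\<^bsub>localization R S\<^esub>} \<longleftrightarrow> (\<forall>x\<in>I. \<exists>t\<in>S. t \<otimes> x = \<zero>)"
proof -
  interpret I: ideal I R by fact
  have zero: "loc_frac R S x s = \<zero>\<^bsub>localization R S\<^esub> \<longleftrightarrow> (\<exists>t\<in>S. t \<otimes> x = \<zero>)"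
    if "x \<in> I" "s \<in> S" for x s
  proof -
    have "loc_frac R S x s = loc_frac R S \<zero> \<one> \<longleftrightarrow> (\<exists>t\<in>S. t \<otimes> (\<one> \<otimes> x) = t \<otimes> (s \<otimes> \<zero>))"
      using that I.Icarr by (intro loc_frac_eq_iff) auto
    also have "\<dots> \<longleftrightarrow> (\<exists>t\<in>S. t \<otimes> x = \<zero>)"
      using that I.Icarr S_carr by (intro bex_cong) auto
    finally show ?thesis by (simp add: loc_zero)
  qed
  have "loc_frac R S \<zero> \<one> \<in> loc_ideal R S I"
    unfolding loc_ideal_def using I.zero_closed one_closed by blast
  then have "loc_ideal R S I = {\<zero>\<^bsub>localization R S\<^esub>} \<longleftrightarrow>
      (\<forall>x\<in>loc_ideal R S I. x = \<zero>\<^bsub>localization R S\<^esub>)"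
    unfolding loc_zero by auto
  also have "\<dots> \<longleftrightarrow> (\<forall>x\<in>I. \<forall>s\<in>S. loc_frac R S x s = \<zero>\<^bsub>localization R S\<^esub>)"
    by (auto simp: loc_ideal_def)
  also have "\<dots> \<longleftrightarrow> (\<forall>x\<in>I. \<forall>s\<in>S. \<exists>t\<in>S. t \<otimes> x = \<zero>)"
    by (intro ball_cong refl zero)
  also have "\<dots> \<longleftrightarrow> (\<forall>x\<in>I. \<exists>t\<in>S. t \<otimes> x = \<zero>)"
    using one_closed by blast
  finally show ?thesis .
qed

text \<open>
  The saturation of \<open>I\<close>, i.e. its preimage under extension to \<open>S\<inverse>R\<close>. It lets local containment in
  \<open>I\<close> pass from generators to the ideal they generate.
\<close>

lemma (in mult_subset) saturation_ideal:
  assumes I: "ideal I R"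
  shows "ideal {r \<in> carrier R. \<exists>s\<in>S. s \<otimes> r \<in> I} R" (is "ideal ?E R")
proof (rule idealI[OF ring_axioms])
  interpret I: ideal I R by fact
  show "subgroup ?E (add_monoid R)"
  proof (rule add.subgroupI)
    show "?E \<noteq> {}" using I.zero_closed by (auto intro!: exI[of _ \<zero>] bexI[of _ \<one>])
    fix r assume "r \<in> ?E"
    then obtain s where s: "r \<in> carrier R" "s \<in> S" "s \<otimes> r \<in> I" by auto
    then have "s \<otimes> \<ominus> r \<in> I" using S_carr I.a_inv_closed by (simp add: r_minus)
    then show "\<ominus> r \<in> ?E" using s by auto
  next
    fix r r' assume "r \<in> ?E" "r' \<in> ?E"
    then obtain s s' where s: "r \<in> carrier R" "s \<in> S" "s \<otimes> r \<in> I"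
      and s': "r' \<in> carrier R" "s' \<in> S" "s' \<otimes> r' \<in> I" by auto
    have "s' \<otimes> (s \<otimes> r) \<oplus> s \<otimes> (s' \<otimes> r') \<in> I"
      using s s' S_carr by (simp add: I.I_l_closed)
    also have "s' \<otimes> (s \<otimes> r) \<oplus> s \<otimes> (s' \<otimes> r') = (s \<otimes> s') \<otimes> (r \<oplus> r')"
      using s s' S_carr by (simp add: r_distr m_ac)
    finally show "r \<oplus> r' \<in> ?E" using s s' by auto
  qed auto
  fix r x assume "r \<in> ?E" and x: "x \<in> carrier R"
  then obtain s where s: "r \<in> carrier R" "s \<in> S" "s \<otimes> r \<in> I" by auto
  then have "s \<otimes> (x \<otimes> r) \<in> I"
    using x S_carr I.I_l_closed[of "s \<otimes> r" x] by (simp add: m_lcomm)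
  then show "x \<otimes> r \<in> ?E" "r \<otimes> x \<in> ?E" using s x by (auto simp: m_comm)
qed

text \<open>
  The fraction \<open>c / 1\<close> generates \<open>S\<inverse>I\<close>: from \<open>t r = q c\<close> one gets \<open>r / s = (q / t s) (c / 1)\<close>.
\<close>

lemma (in mult_subset) loc_ideal_principal:
  assumes I: "ideal I R" and c: "c \<in> I" and gen: "\<And>r. r \<in> I \<Longrightarrow> \<exists>s\<in>S. s \<otimes> r \<in> PIdl c"
  shows "principalideal (loc_ideal R S I) (localization R S)"
proof (rule principalidealI)
  interpret L: cring "localization R S" by (rule cring_localization)
  interpret I: ideal I R by fact
  have cc: "c \<in> carrier R" using c by (rule I.Icarr)
  have cl: "loc_frac R S c \<one> \<in> carrier (localization R S)" using cc by (simp add: frac_closed)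
  show LI: "ideal (loc_ideal R S I) (localization R S)" by (rule ideal_loc_ideal[OF I])
  have "loc_ideal R S I = PIdl\<^bsub>localization R S\<^esub> (loc_frac R S c \<one>)"
  proof
    have "loc_frac R S c \<one> \<in> loc_ideal R S I"
      unfolding loc_ideal_def using c one_closed by blast
    then show "PIdl\<^bsub>localization R S\<^esub> (loc_frac R S c \<one>) \<subseteq> loc_ideal R S I"
      by (rule L.cgenideal_minimal[OF LI])
    show "loc_ideal R S I \<subseteq> PIdl\<^bsub>localization R S\<^esub> (loc_frac R S c \<one>)"
    proof
      fix x assume "x \<in> loc_ideal R S I"
      then obtain r s where x: "r \<in> I" "s \<in> S" "x = loc_frac R S r s"
        by (auto simp: loc_ideal_def)
      obtain t q where t: "t \<in> S" "q \<in> carrier R" "t \<otimes> r = q \<otimes> c"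
        using gen[OF x(1)] by (auto simp: cgenideal_def)
      have rc: "r \<in> carrier R" using x(1) by (rule I.Icarr)
      have "loc_frac R S q (t \<otimes> s) \<otimes>\<^bsub>localization R S\<^esub> loc_frac R S c \<one> =
          loc_frac R S (q \<otimes> c) (t \<otimes> s)"
        using t x cc S_carr by (simp add: loc_mult_frac)
      also have "\<dots> = loc_frac R S (t \<otimes> r) (t \<otimes> s)" by (simp only: t(3))
      also have "\<dots> = x" unfolding x(3)
        using t(1) x(2) rc S_carr by (intro frac_cong) (auto simp: m_ac)
      finally show "x \<in> PIdl\<^bsub>localization R S\<^esub> (loc_frac R S c \<one>)"
        unfolding cgenideal_def using frac_closed[of q "t \<otimes> s"] t x by blast
    qed
  qed
  then show "\<exists>i\<in>carrier (localization R S). loc_ideal R S I = Idl\<^bsub>localization R S\<^esub> {i}"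
    using cl L.cgenideal_eq_genideal by metis
qed

section \<open>Comparing two elements by divisibility\<close>

text \<open>
  The ideal quotient \<open>(bR : a)\<close>.
\<close>

definition colon :: "('a, 'm) ring_scheme \<Rightarrow> 'a \<Rightarrow> 'a \<Rightarrow> 'a set" where
  "colon R b a = {u \<in> carrier R. b divides\<^bsub>R\<^esub> u \<otimes>\<^bsub>R\<^esub> a}"

text \<open>
  The ideal \<open>(bR : a) + (aR : b)\<close>. A prime \<open>P\<close> fails to contain it exactly when one of \<open>a\<close>, \<open>b\<close>
  divides the other in \<open>R\<^sub>P\<close>, so it is the unit ideal iff \<open>a\<close> and \<open>b\<close> are comparable everywhere
  locally.
\<close>

definition comparison :: "('a, 'm) ring_scheme \<Rightarrow> 'a \<Rightarrow> 'a \<Rightarrow> 'a set" where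
  "comparison R a b = colon R b a <+>\<^bsub>R\<^esub> colon R a b"

lemma (in cring) colon_ideal:
  assumes a: "a \<in> carrier R" and b: "b \<in> carrier R"
  shows "ideal (colon R b a) R"
proof (rule idealI[OF ring_axioms])
  have dvd: "u \<in> colon R b a \<longleftrightarrow> u \<in> carrier R \<and> u \<otimes> a \<in> PIdl b" for u
    using b by (auto simp: colon_def factor_def cgenideal_def m_comm)
  interpret P: ideal "PIdl b" R by (rule cgenideal_ideal[OF b])
  show "subgroup (colon R b a) (add_monoid R)"
  proof (rule add.subgroupI)
    show "colon R b a \<subseteq> carrier R" by (auto simp: colon_def)
    show "colon R b a \<noteq> {}" using dvd[of \<zero>] a P.zero_closed by auto
  qed (use a in \<open>auto simp: dvd l_distr l_minus P.a_inv_closed\<close>)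
  fix u x assume "u \<in> colon R b a" "x \<in> carrier R"
  then show "x \<otimes> u \<in> colon R b a" and "u \<otimes> x \<in> colon R b a"
    using a P.I_l_closed[of "u \<otimes> a" x] m_comm[of u x] by (auto simp: dvd m_assoc)
qed

lemma (in cring) comparison_ideal:
  "a \<in> carrier R \<Longrightarrow> b \<in> carrier R \<Longrightarrow> ideal (comparison R a b) R"
  unfolding comparison_def by (intro add_ideals colon_ideal)

lemma comparison_iff:
  "x \<in> comparison R a b \<longleftrightarrow> (\<exists>u\<in>carrier R. \<exists>v\<in>carrier R.
    b divides\<^bsub>R\<^esub> u \<otimes>\<^bsub>R\<^esub> a \<and> a divides\<^bsub>R\<^esub> v \<otimes>\<^bsub>R\<^esub> b \<and> x = u \<oplus>\<^bsub>R\<^esub> v)"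
  by (auto simp: comparison_def colon_def set_add_def')

lemma (in cring) colon_subset_comparison:
  assumes "a \<in> carrier R" "b \<in> carrier R"
  shows "colon R b a \<subseteq> comparison R a b" "colon R a b \<subseteq> comparison R a b"
proof -
  interpret u: ideal "colon R b a" R using assms by (intro colon_ideal)
  interpret v: ideal "colon R a b" R using assms by (intro colon_ideal)
  have "u \<oplus> \<zero> \<in> comparison R a b" if "u \<in> colon R b a" for u
    unfolding comparison_def set_add_def' using that v.zero_closed by blast
  moreover have "\<zero> \<oplus> v \<in> comparison R a b" if "v \<in> colon R a b" for v
    unfolding comparison_def set_add_def' using that u.zero_closed by blast
  ultimately show "colon R b a \<subseteq> comparison R a b" "colon R a b \<subseteq> comparison R a b"
    using u.Icarr v.Icarr by fastforce+
qed

section \<open>Arithmetical rings\<close>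

lemma (in cring) genideal_pairE:
  assumes "a \<in> carrier R" "b \<in> carrier R" "x \<in> Idl {a, b}"
  obtains y z where "y \<in> carrier R" "z \<in> carrier R" "x = y \<otimes> a \<oplus> z \<otimes> b"
proof -
  have "ideal (PIdl a <+>\<^bsub>R\<^esub> PIdl b) R"
    using assms by (intro add_ideals cgenideal_ideal)
  moreover have "PIdl a <+>\<^bsub>R\<^esub> PIdl b = Idl (PIdl a \<union> PIdl b)"
    using assms by (intro union_genideal[symmetric] cgenideal_ideal)
  moreover have "PIdl a \<subseteq> carrier R" "PIdl b \<subseteq> carrier R"
    using assms by (auto simp: cgenideal_def)
  ultimately have "Idl {a, b} \<subseteq> PIdl a <+>\<^bsub>R\<^esub> PIdl b"
    using assms cgenideal_self genideal_self[of "PIdl a \<union> PIdl b"]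
    by (intro genideal_minimal) auto
  then show thesis
    using that assms(3) by (auto simp: set_add_def' cgenideal_def)
qed

text \<open>
  Here \<open>d\<close> is a common divisor of \<open>a\<close> and \<open>b\<close> locally at \<open>M\<close>, with quotients \<open>r1 / s1\<close> and
  \<open>r2 / s2\<close>. If one quotient is a local unit, the corresponding element is itself a local generator
  of the pair. Otherwise substituting the quotients into \<open>d = y a + z b\<close> gives \<open>s1 s2 d = e d\<close> with
  \<open>e\<close> in \<open>M\<close>; as \<open>s1 s2 - e\<close> is a local unit, \<open>d\<close> and therefore \<open>a\<close> and \<open>b\<close> vanish locally
  (Nakayama's argument for one generator).
\<close>

lemma (in cring) divides_of_common_generator:
  assumes M: "primeideal M R"
    and a: "a \<in> carrier R" and b: "b \<in> carrier R"
    and y: "y \<in> carrier R" and z: "z \<in> carrier R" and d: "d = y \<otimes> a \<oplus> z \<otimes> b"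
    and s1: "s1 \<in> carrier R - M" and r1: "r1 \<in> carrier R" and e1: "s1 \<otimes> a = r1 \<otimes> d"
    and s2: "s2 \<in> carrier R - M" and r2: "r2 \<in> carrier R" and e2: "s2 \<otimes> b = r2 \<otimes> d"
  shows "\<exists>w\<in>carrier R - M. b divides w \<otimes> a \<or> a divides w \<otimes> b"
proof -
  interpret P: primeideal M R by fact
  have compl: "v \<otimes> w \<in> carrier R - M" if "v \<in> carrier R - M" "w \<in> carrier R - M" for v w
    using that P.I_prime[of v w] by auto
  have sc: "s1 \<in> carrier R" "s2 \<in> carrier R" using s1 s2 by auto
  have dc: "d \<in> carrier R" using a b y z by (simp add: d)
  consider "r1 \<notin> M" | "r2 \<notin> M" | "r1 \<in> M" "r2 \<in> M" by blast
  then show ?thesis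
  proof cases
    case 1
    have "r1 \<otimes> s2 \<otimes> b = r1 \<otimes> (r2 \<otimes> d)" using r1 b sc by (simp add: m_assoc e2)
    also have "\<dots> = r2 \<otimes> (s1 \<otimes> a)" unfolding e1 using r1 r2 dc by (rule m_lcomm)
    also have "\<dots> = a \<otimes> (r2 \<otimes> s1)" using a r2 sc by (simp add: m_ac)
    finally have "a divides r1 \<otimes> s2 \<otimes> b" using r2 sc by (auto simp: factor_def)
    then show ?thesis using compl[of r1 s2] 1 r1 s2 by blast
  next
    case 2
    have "r2 \<otimes> s1 \<otimes> a = r2 \<otimes> (r1 \<otimes> d)" using r2 a sc by (simp add: m_assoc e1)
    also have "\<dots> = r1 \<otimes> (s2 \<otimes> b)" unfolding e2 using r2 r1 dc by (rule m_lcomm)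
    also have "\<dots> = b \<otimes> (r1 \<otimes> s2)" using b r1 sc by (simp add: m_ac)
    finally have "b divides r2 \<otimes> s1 \<otimes> a" using r1 sc by (auto simp: factor_def)
    then show ?thesis using compl[of r2 s1] 2 r2 s1 by blast
  next
    case 3
    define e where "e = y \<otimes> s2 \<otimes> r1 \<oplus> z \<otimes> s1 \<otimes> r2"
    have e: "e \<in> M" unfolding e_def using 3 y z sc by (simp add: P.I_l_closed)
    then have ec: "e \<in> carrier R" by (rule P.Icarr)
    have "s1 \<otimes> s2 \<otimes> d = y \<otimes> s2 \<otimes> (s1 \<otimes> a) \<oplus> z \<otimes> s1 \<otimes> (s2 \<otimes> b)"
      unfolding d using y z a b sc by (simp add: r_distr m_ac)
    also have "\<dots> = e \<otimes> d"
      unfolding e_def e1 e2 using y z dc sc r1 r2 by (simp add: l_distr m_assoc)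
    finally have wd: "(s1 \<otimes> s2 \<ominus> e) \<otimes> d = \<zero>"
      using sc ec dc by (simp add: a_minus_def l_distr l_minus r_neg)
    have "(s1 \<otimes> s2 \<ominus> e) \<otimes> s1 \<otimes> a = (s1 \<otimes> s2 \<ominus> e) \<otimes> (r1 \<otimes> d)"
      using sc ec a by (simp add: m_assoc e1)
    also have "\<dots> = r1 \<otimes> ((s1 \<otimes> s2 \<ominus> e) \<otimes> d)"
      using sc ec dc r1 by (intro m_lcomm) auto
    also have "\<dots> = b \<otimes> \<zero>" using wd r1 b by simp
    finally have "b divides (s1 \<otimes> s2 \<ominus> e) \<otimes> s1 \<otimes> a"
      by (auto simp: factor_def)
    moreover have "s1 \<otimes> s2 \<ominus> e \<notin> M"
    proof
      assume "s1 \<otimes> s2 \<ominus> e \<in> M"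
      then have "s1 \<otimes> s2 \<ominus> e \<oplus> e \<in> M" using e by simp
      then have "s1 \<otimes> s2 \<in> M" using sc ec by (simp add: a_minus_def a_assoc l_neg)
      then show False using compl[OF s1 s2] by blast
    qed
    then have "(s1 \<otimes> s2 \<ominus> e) \<otimes> s1 \<in> carrier R - M"
      using s1 sc ec by (intro compl) auto
    ultimately show ?thesis by blast
  qed
qed

text \<open>
  Only the localized ideal of the pair is principal; clearing denominators in its generator and in
  the two quotients yields the equations of \<open>divides_of_common_generator\<close> in \<open>R\<close> itself.
\<close>

lemma (in cring) locally_principal_pair_imp:
  assumes a: "a \<in> carrier R" and b: "b \<in> carrier R" and M: "maximalideal M R"
    and lp: "principalideal (loc_ideal R (carrier R - M) (Idl {a, b})) (localization R (carrier R - M))"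
  shows "\<exists>w\<in>carrier R - M. b divides w \<otimes> a \<or> a divides w \<otimes> b"
proof -
  interpret M: maximalideal M R by fact
  interpret P: primeideal M R by (rule maximalideal_prime[OF M])
  interpret T: mult_subset R "carrier R - M" by (rule P.mult_subset_compl)
  let ?S = "carrier R - M" and ?L = "localization R (carrier R - M)"
  interpret L: cring ?L by (rule T.cring_localization)
  have ab: "{a, b} \<subseteq> carrier R" using a b by simp
  interpret I: ideal "Idl {a, b}" R by (rule genideal_ideal[OF ab])
  obtain c where c: "c \<in> carrier ?L" "loc_ideal R ?S (Idl {a, b}) = PIdl\<^bsub>?L\<^esub> c"
    using principalideal.generate[OF lp] L.cgenideal_eq_genideal by metis
  then have "c \<in> loc_ideal R ?S (Idl {a, b})" using L.cgenideal_self by simp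
  then obtain d s where d: "d \<in> Idl {a, b}" "s \<in> ?S" "c = loc_frac R ?S d s"
    by (auto simp: loc_ideal_def)
  have dc: "d \<in> carrier R" using d(1) by (rule I.Icarr)
  obtain y z where yz: "y \<in> carrier R" "z \<in> carrier R" "d = y \<otimes> a \<oplus> z \<otimes> b"
    using genideal_pairE[OF a b d(1)] .
  have fraction: "\<exists>t\<in>?S. \<exists>r\<in>carrier R. t \<otimes> x = r \<otimes> d" if x: "x \<in> {a, b}" for x
  proof -
    have xc: "x \<in> carrier R" using x a b by auto
    have "x \<in> Idl {a, b}" using genideal_self[OF ab] x by blast
    then have "loc_frac R ?S x \<one> \<in> PIdl\<^bsub>?L\<^esub> c"
      unfolding c(2)[symmetric] loc_ideal_def using T.one_closed by blast
    then obtain e where e: "e \<in> carrier ?L" "loc_frac R ?S x \<one> = e \<otimes>\<^bsub>?L\<^esub> c"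
      by (auto simp: cgenideal_def)
    obtain r r' where r: "r \<in> carrier R" "r' \<in> ?S" "e = loc_frac R ?S r r'"
      using T.loc_cases[OF e(1)] by metis
    have "loc_frac R ?S x \<one> = loc_frac R ?S (r \<otimes> d) (r' \<otimes> s)"
      using e(2) r d dc by (simp add: T.loc_mult_frac)
    then obtain t where t: "t \<in> ?S" "t \<otimes> ((r' \<otimes> s) \<otimes> x) = t \<otimes> (\<one> \<otimes> (r \<otimes> d))"
      using r d dc xc T.one_closed T.m_closed[of r' s] by (subst (asm) T.loc_frac_eq_iff) auto
    have "t \<otimes> (r' \<otimes> s) \<in> ?S" using t r d by (intro T.m_closed)
    moreover have "t \<otimes> (r' \<otimes> s) \<otimes> x = t \<otimes> r \<otimes> d"
      using t r d dc xc by (simp add: m_assoc)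
    ultimately show ?thesis using t r by blast
  qed
  obtain s1 r1 where "s1 \<in> ?S" "r1 \<in> carrier R" "s1 \<otimes> a = r1 \<otimes> d" using fraction[of a] by auto
  moreover obtain s2 r2 where "s2 \<in> ?S" "r2 \<in> carrier R" "s2 \<otimes> b = r2 \<otimes> d"
    using fraction[of b] by auto
  ultimately show ?thesis
    using divides_of_common_generator[OF P.primeideal_axioms a b yz] by blast
qed

lemma (in primeideal) in_compl_of_sum_one:
  assumes "u \<in> carrier R" "v \<in> carrier R" "u \<oplus> v = \<one>"
  shows "u \<in> carrier R - I \<or> v \<in> carrier R - I"
  using assms additive_subgroup.a_closed[OF additive_subgroup_axioms, of u v]
    one_imp_carrier I_notcarr by auto

text \<open>
  Locally at \<open>M\<close> divisibility is total on a finite set of generators, so one of them (or zero, for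
  the empty set) divides all the others there.
\<close>

lemma (in cring) comparable_imp_local_generator:
  assumes M: "primeideal M R"
    and comp: "\<And>a b. a \<in> carrier R \<Longrightarrow> b \<in> carrier R \<Longrightarrow> \<one> \<in> comparison R a b"
    and T: "finite T" "T \<subseteq> carrier R"
  shows "\<exists>c\<in>Idl T. \<forall>t\<in>T. \<exists>s\<in>carrier R - M. c divides s \<otimes> t"
  using T
proof (induction T)
  case empty
  have "ideal (Idl {}) R" by (rule genideal_ideal) simp
  then show ?case
    using additive_subgroup.zero_closed[OF ideal.axioms(1)] by auto
next
  case (insert x T)
  interpret M: primeideal M R by fact
  interpret S: mult_subset R "carrier R - M" by (rule M.mult_subset_compl)
  obtain c where c: "c \<in> Idl T" "\<forall>t\<in>T. \<exists>s\<in>carrier R - M. c divides s \<otimes> t"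
    using insert by auto
  have cc: "c \<in> carrier R" using c(1) genideal_ideal[of T] insert.prems by (simp add: ideal.Icarr)
  have xc: "x \<in> carrier R" using insert by simp
  have sub: "insert x T \<subseteq> Idl (insert x T)" using insert.prems by (rule genideal_self)
  then have "Idl T \<subseteq> Idl (insert x T)"
    using insert.prems by (intro genideal_minimal genideal_ideal) auto
  then have c_mem: "c \<in> Idl (insert x T)" using c by blast
  obtain u v where uv: "u \<in> carrier R" "v \<in> carrier R" "u \<oplus> v = \<one>"
      "x divides u \<otimes> c" "c divides v \<otimes> x"
    using comp[OF cc xc] by (auto simp: comparison_iff)
  consider "u \<in> carrier R - M" | "v \<in> carrier R - M" using M.in_compl_of_sum_one[OF uv(1-3)] by blast
  then show ?case
  proof cases
    case 1
    have "\<exists>s\<in>carrier R - M. x divides s \<otimes> t" if t: "t \<in> insert x T" for t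
    proof (cases "t = x")
      case True
      have "x divides \<one> \<otimes> x" using xc by simp
      then show ?thesis using S.one_closed True by blast
    next
      case False
      then obtain s where s: "s \<in> carrier R - M" "c divides s \<otimes> t" using t c by blast
      have tc: "t \<in> carrier R" using t insert.prems by blast
      have "u \<otimes> c divides u \<otimes> (s \<otimes> t)"
        using s uv cc tc by (intro divides_mult_lI) auto
      then have "x divides (u \<otimes> s) \<otimes> t"
        using divides_trans[OF uv(4)] xc s uv tc by (simp add: m_assoc)
      then show ?thesis using S.m_closed[OF 1 s(1)] by blast
    qed
    then show ?thesis using sub by blast
  next
    case 2
    then show ?thesis using c uv c_mem by blast
  qed
qed

text \<open>
  If \<open>a\<close> and \<open>b\<close> have proper comparison ideal, then at a maximal ideal above it the pair \<open>{a, b}\<close> is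
  not locally principal. Conversely, comparability of pairs gives every finite set a local generator.
\<close>

theorem arithmetical_ring_iff_comparable:
  fixes R (structure)
  shows "arithmetical_ring R \<longleftrightarrow>
    cring R \<and> (\<forall>a\<in>carrier R. \<forall>b\<in>carrier R. \<one> \<in> comparison R a b)"
proof
  assume R: "arithmetical_ring R"
  then interpret cring R by (simp add: arithmetical_ring_def)
  have "\<one> \<in> comparison R a b" if ab: "a \<in> carrier R" "b \<in> carrier R" for a b
  proof (rule ccontr)
    assume "\<one> \<notin> comparison R a b"
    then obtain M where M: "maximalideal M R" "comparison R a b \<subseteq> M"
      using exists_maximalideal[OF comparison_ideal[OF ab]] one_closed by blast
    have "fg_ideal R (Idl {a, b})" unfolding fg_ideal_def using ab by (intro exI[of _ "{a, b}"]) simp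
    then have "principalideal (loc_ideal R (carrier R - M) (Idl {a, b})) (localization R (carrier R - M))"
      using R M by (auto simp: arithmetical_ring_def locally_principal_def)
    then obtain w where "w \<in> carrier R - M" "b divides w \<otimes> a \<or> a divides w \<otimes> b"
      using locally_principal_pair_imp[OF ab M(1)] by blast
    then have "w \<in> colon R b a \<or> w \<in> colon R a b" by (auto simp: colon_def)
    then show False using colon_subset_comparison[OF ab] M \<open>w \<in> carrier R - M\<close> by blast
  qed
  then show "cring R \<and> (\<forall>a\<in>carrier R. \<forall>b\<in>carrier R. \<one> \<in> comparison R a b)"
    using is_cring by blast
next
  assume *: "cring R \<and> (\<forall>a\<in>carrier R. \<forall>b\<in>carrier R. \<one> \<in> comparison R a b)"
  then interpret cring R by blast
  \<comment> \<open>The saturation of \<open>PIdl c\<close> is an ideal containing \<open>T\<close>, hence it contains all of \<open>Idl T\<close>.\<close>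
  have "locally_principal R (Idl T)" if T: "finite T" "T \<subseteq> carrier R" for T
    unfolding locally_principal_def
  proof (intro allI impI)
    fix M assume "maximalideal M R"
    then interpret M: primeideal M R by (rule maximalideal_prime)
    interpret S: mult_subset R "carrier R - M" by (rule M.mult_subset_compl)
    obtain c where c: "c \<in> Idl T" "\<forall>t\<in>T. \<exists>s\<in>carrier R - M. c divides s \<otimes> t"
      using comparable_imp_local_generator[OF M.primeideal_axioms _ T] * by auto
    have I: "ideal (Idl T) R" using T by (intro genideal_ideal)
    have cc: "c \<in> carrier R" using I c(1) by (rule ideal.Icarr)
    have "\<exists>s\<in>carrier R - M. s \<otimes> t \<in> PIdl c" if "t \<in> T" for t
      using c(2) that cc unfolding factor_def cgenideal_def by (metis (mono_tags, lifting) m_comm mem_Collect_eq)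
    then have "Idl T \<subseteq> {r \<in> carrier R. \<exists>s\<in>carrier R - M. s \<otimes> r \<in> PIdl c}"
      using T cc by (intro genideal_minimal S.saturation_ideal cgenideal_ideal) auto
    then show "principalideal (loc_ideal R (carrier R - M) (Idl T)) (localization R (carrier R - M))"
      by (intro S.loc_ideal_principal[OF I c(1)]) blast
  qed
  then show "arithmetical_ring R"
    using is_cring by (auto simp: arithmetical_ring_def fg_ideal_def)
qed

section \<open>Chained rings\<close>

text \<open>
  An element of \<open>L\<close> outside \<open>I\<close> is not divisible by any element of \<open>I\<close>, hence divides all of them.
\<close>

lemma (in cring) ideals_comparable:
  assumes total: "\<And>a b. a \<in> carrier R \<Longrightarrow> b \<in> carrier R \<Longrightarrow> a divides b \<or> b divides a"
    and I: "ideal I R" and L: "ideal L R"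
  shows "I \<subseteq> L \<or> L \<subseteq> I"
proof (rule disjCI)
  have closed: "y \<in> K" if "ideal K R" "x \<in> K" "x divides y" for K x y
    using that ideal.I_r_closed[OF that(1,2)] by (auto simp: factor_def)
  assume "\<not> L \<subseteq> I"
  then obtain x where x: "x \<in> L" "x \<notin> I" by auto
  show "I \<subseteq> L"
  proof
    fix y assume y: "y \<in> I"
    have "x divides y \<or> y divides x"
      using total[OF ideal.Icarr[OF L x(1)] ideal.Icarr[OF I y]] .
    then show "y \<in> L" using closed[OF I y, of x] closed[OF L x(1), of y] x(2) by auto
  qed
qed

text \<open>
  In a local ring one of two elements with sum one is a unit, so comparability becomes divisibility.
  Conversely, total divisibility makes the ideals totally ordered, which leaves room for one maximal
  ideal only.
\<close>

theorem chained_ring_iff_divides_total: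
  fixes R (structure)
  shows "chained_ring R \<longleftrightarrow> cring R \<and> \<one> \<noteq> \<zero> \<and>
    (\<forall>a\<in>carrier R. \<forall>b\<in>carrier R. a divides b \<or> b divides a)"
proof
  assume R: "chained_ring R"
  then interpret cring R by (simp add: chained_ring_def local_ring_def)
  obtain M where M: "maximalideal M R" "\<And>N. maximalideal N R \<Longrightarrow> N = M"
    using R by (auto simp: chained_ring_def local_ring_def)
  interpret M: primeideal M R by (rule maximalideal_prime[OF M(1)])
  have unit: "\<exists>w\<in>carrier R. w \<otimes> u = \<one>" if u: "u \<in> carrier R - M" for u
  proof -
    have "PIdl u = carrier R"
    proof (rule ccontr)
      assume "PIdl u \<noteq> carrier R"
      then have "PIdl u \<subseteq> M"
        using exists_maximalideal[OF cgenideal_ideal[of u]] M(2) u by blast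
      then show False using cgenideal_self[of u] u by blast
    qed
    then have "\<one> \<in> PIdl u" by simp
    then show ?thesis by (auto simp: cgenideal_def)
  qed
  have cancel: "b divides a"
    if u_notin: "u \<in> carrier R - M" and dvd: "b divides u \<otimes> a"
      and ab: "a \<in> carrier R" "b \<in> carrier R" for u a b
  proof -
    obtain w where w: "w \<in> carrier R" "w \<otimes> u = \<one>" using unit[OF u_notin] by blast
    have uc: "u \<in> carrier R" using u_notin by simp
    have "b divides w \<otimes> (u \<otimes> a)" using dvd ab uc w(1) by (simp add: divides_prod_l)
    also have "w \<otimes> (u \<otimes> a) = a" using ab uc w by (simp add: m_assoc[symmetric])
    finally show ?thesis .
  qed
  have "a divides b \<or> b divides a" if ab: "a \<in> carrier R" "b \<in> carrier R" for a b
  proof -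
    have "\<one> \<in> comparison R a b"
      using R ab by (simp add: chained_ring_def arithmetical_ring_iff_comparable)
    then obtain u v where uv: "u \<in> carrier R" "v \<in> carrier R" "u \<oplus> v = \<one>"
        "b divides u \<otimes> a" "a divides v \<otimes> b"
      by (auto simp: comparison_iff)
    then show ?thesis using M.in_compl_of_sum_one[OF uv(1-3)] cancel ab by blast
  qed
  moreover have "\<one> \<noteq> \<zero>"
    using M.one_imp_carrier M.I_notcarr M.zero_closed by metis
  ultimately show "cring R \<and> \<one> \<noteq> \<zero> \<and>
      (\<forall>a\<in>carrier R. \<forall>b\<in>carrier R. a divides b \<or> b divides a)"
    using is_cring by blast
next
  assume *: "cring R \<and> \<one> \<noteq> \<zero> \<and>
    (\<forall>a\<in>carrier R. \<forall>b\<in>carrier R. a divides b \<or> b divides a)"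
  then interpret cring R by blast
  have total: "a divides b \<or> b divides a" if "a \<in> carrier R" "b \<in> carrier R" for a b
    using * that by blast
  have "\<one> \<in> comparison R a b" if ab: "a \<in> carrier R" "b \<in> carrier R" for a b
  proof -
    have "b divides \<one> \<otimes> a \<or> a divides \<one> \<otimes> b" using total ab by auto
    then have "\<one> \<in> colon R b a \<or> \<one> \<in> colon R a b" by (auto simp: colon_def)
    then show ?thesis using colon_subset_comparison[OF ab] by blast
  qed
  then have "arithmetical_ring R" using is_cring by (simp add: arithmetical_ring_iff_comparable)
  moreover have "\<exists>!M. maximalideal M R"
  proof -
    have "\<exists>M. maximalideal M R"
      using exists_maximalideal[OF zeroideal] * one_closed by blast
    moreover have "N = M" if M: "maximalideal M R" and N: "maximalideal N R" for M N
    proof -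
      have MN: "ideal M R" "ideal N R" "M \<noteq> carrier R" "N \<noteq> carrier R"
        "M \<subseteq> carrier R" "N \<subseteq> carrier R"
        using M N maximalideal.axioms(1) maximalideal.I_notcarr ideal.Icarr by fastforce+
      from ideals_comparable[OF total MN(1,2)] show ?thesis
      proof
        assume "M \<subseteq> N"
        then show ?thesis using maximalideal.I_maximal[OF M MN(2)] MN(4,6) by simp
      next
        assume "N \<subseteq> M"
        then show ?thesis using maximalideal.I_maximal[OF N MN(1)] MN(3,5) by simp
      qed
    qed
    ultimately show ?thesis by blast
  qed
  ultimately show "chained_ring R"
    using is_cring by (simp add: chained_ring_def local_ring_def)
qed

section \<open>Surjective homomorphisms\<close>

lemma (in cring) eq_one_minus:
  assumes "u \<in> carrier R" "v \<in> carrier R" "\<one> = u \<oplus> v"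
  shows "v = \<one> \<ominus> u"
  unfolding assms(3) a_comm[OF assms(1,2)] using assms(1,2) by (simp add: a_minus_def a_assoc r_neg)

lemma (in cring) add_one_minus: "u \<in> carrier R \<Longrightarrow> u \<oplus> (\<one> \<ominus> u) = \<one>"
  using a_lcomm[of u \<one> "\<ominus> u"] by (simp add: a_minus_def r_neg)

locale surjective_ring_hom = ring_hom_cring +
  assumes surj: "h ` carrier R = carrier S"
begin

lemma lift_closed:
  assumes "y \<in> carrier S"
  obtains x where "x \<in> carrier R" "y = h x"
  using assms unfolding surj[symmetric] by auto

lemma mem_kernel_iff: "x \<in> a_kernel R S h \<longleftrightarrow> x \<in> carrier R \<and> h x = \<zero>\<^bsub>S\<^esub>"
  unfolding a_kernel_def' by simp

lemma kernel_diff: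
  assumes "x \<in> carrier R" "y \<in> carrier R" "h x = h y"
  shows "x \<ominus> y \<in> a_kernel R S h"
  using assms by (simp add: mem_kernel_iff a_minus_def S.r_neg)

lemma hom_divides: "a \<in> carrier R \<Longrightarrow> a divides b \<Longrightarrow> h a divides\<^bsub>S\<^esub> h b"
  by (auto simp: factor_def)

lemma arithmetical_image:
  assumes "arithmetical_ring R"
  shows "arithmetical_ring S"
proof -
  have "\<one>\<^bsub>S\<^esub> \<in> comparison S a' b'" if ab': "a' \<in> carrier S" "b' \<in> carrier S" for a' b'
  proof -
    obtain a where a: "a \<in> carrier R" "a' = h a" using ab'(1) by (rule lift_closed)
    obtain b where b: "b \<in> carrier R" "b' = h b" using ab'(2) by (rule lift_closed)
    have "\<one> \<in> comparison R a b"
      using assms a(1) b(1) by (simp add: arithmetical_ring_iff_comparable)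
    then obtain u v where uv: "u \<in> carrier R" "v \<in> carrier R" "\<one> = u \<oplus> v"
        "b divides u \<otimes> a" "a divides v \<otimes> b"
      unfolding comparison_iff by blast
    have "\<one>\<^bsub>S\<^esub> = h u \<oplus>\<^bsub>S\<^esub> h v" using uv(1,2) uv(3)[symmetric] by (simp flip: hom_add)
    moreover have "h b divides\<^bsub>S\<^esub> h u \<otimes>\<^bsub>S\<^esub> h a" "h a divides\<^bsub>S\<^esub> h v \<otimes>\<^bsub>S\<^esub> h b"
      using hom_divides[OF b(1) uv(4)] hom_divides[OF a(1) uv(5)] uv(1,2) a(1) b(1) by simp_all
    ultimately show ?thesis
      unfolding comparison_iff a(2) b(2) using uv(1,2) by blast
  qed
  then show ?thesis using S.is_cring by (simp add: arithmetical_ring_iff_comparable)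
qed

lemma chained_image:
  assumes "chained_ring R" "\<one>\<^bsub>S\<^esub> \<noteq> \<zero>\<^bsub>S\<^esub>"
  shows "chained_ring S"
proof -
  have "a' divides\<^bsub>S\<^esub> b' \<or> b' divides\<^bsub>S\<^esub> a'" if ab': "a' \<in> carrier S" "b' \<in> carrier S" for a' b'
  proof -
    obtain a where a: "a \<in> carrier R" "a' = h a" using ab'(1) by (rule lift_closed)
    obtain b where b: "b \<in> carrier R" "b' = h b" using ab'(2) by (rule lift_closed)
    have "a divides b \<or> b divides a"
      using assms(1) a b by (simp add: chained_ring_iff_divides_total)
    then show ?thesis using hom_divides a b by auto
  qed
  then show ?thesis using assms(2) S.is_cring by (simp add: chained_ring_iff_divides_total)
qed

text \<open>
  Any lift \<open>x\<close> of the quotient works.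
\<close>

lemma divides_of_image_divides:
  assumes ab: "a \<in> carrier R" "b \<in> carrier R" and dvd: "h a divides\<^bsub>S\<^esub> h b"
  shows "\<exists>x\<in>carrier R. b \<ominus> a \<otimes> x \<in> a_kernel R S h"
proof -
  obtain x' where x': "x' \<in> carrier S" "h b = h a \<otimes>\<^bsub>S\<^esub> x'" using dvd by (auto simp: factor_def)
  then obtain x where x: "x \<in> carrier R" "x' = h x" using lift_closed by blast
  then have "b \<ominus> a \<otimes> x \<in> a_kernel R S h"
    using x' ab by (intro kernel_diff) auto
  then show ?thesis using x by blast
qed

lemma chained_of_trivial_kernel:
  assumes S: "chained_ring S" and kernel: "a_kernel R S h = {\<zero>}"
  shows "chained_ring R"
proof -
  have reflect: "a divides b" if "a \<in> carrier R" "b \<in> carrier R" "h a divides\<^bsub>S\<^esub> h b" for a b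
    using divides_of_image_divides[OF that] that by (auto simp: kernel factor_def)
  have "a divides b \<or> b divides a" if ab: "a \<in> carrier R" "b \<in> carrier R" for a b
  proof -
    have "h a divides\<^bsub>S\<^esub> h b \<or> h b divides\<^bsub>S\<^esub> h a"
      using S ab by (simp add: chained_ring_iff_divides_total)
    then show ?thesis using reflect ab by blast
  qed
  moreover have "\<one> \<noteq> \<zero>"
    using S hom_one hom_zero by (metis chained_ring_iff_divides_total)
  ultimately show ?thesis using R.is_cring by (simp add: chained_ring_iff_divides_total)
qed

text \<open>
  Let \<open>u' + v' = 1\<close> compare the images of \<open>a\<close> and \<open>b\<close>. Lift \<open>u'\<close> to \<open>u\<close> and take \<open>v = 1 - u\<close> as the
  lift of \<open>v'\<close>, so that the lifts still add up to one. The two divisibilities then hold with errors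
  \<open>w\<close> and \<open>w'\<close>. Whenever \<open>t\<close> annihilates both, \<open>t u\<close> and \<open>t v\<close> belong to the two colon ideals of
  \<open>a\<close> and \<open>b\<close>, and \<open>t = t u + t v\<close>. Such \<open>t\<close> are found in two ways: in an ideal whose product
  with the kernel is zero, or as denominators when the kernel is locally zero.
\<close>

lemma comparison_of_kernel_annihilator:
  assumes S: "arithmetical_ring S" and ab: "a \<in> carrier R" "b \<in> carrier R"
  obtains w w' where "w \<in> a_kernel R S h" "w' \<in> a_kernel R S h"
    "\<And>t. t \<in> carrier R \<Longrightarrow> t \<otimes> w = \<zero> \<Longrightarrow> t \<otimes> w' = \<zero> \<Longrightarrow> t \<in> comparison R a b"
proof -
  have "\<one>\<^bsub>S\<^esub> \<in> comparison S (h a) (h b)"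
    using S ab by (simp add: arithmetical_ring_iff_comparable)
  then obtain u' v' where uv': "u' \<in> carrier S" "v' \<in> carrier S" "\<one>\<^bsub>S\<^esub> = u' \<oplus>\<^bsub>S\<^esub> v'"
      "h b divides\<^bsub>S\<^esub> u' \<otimes>\<^bsub>S\<^esub> h a" "h a divides\<^bsub>S\<^esub> v' \<otimes>\<^bsub>S\<^esub> h b"
    unfolding comparison_iff by blast
  obtain u where u: "u \<in> carrier R" "u' = h u" using uv'(1) by (rule lift_closed)
  define v where "v = \<one> \<ominus> u"
  have v: "v \<in> carrier R" using u by (simp add: v_def)
  have "v' = h v"
    using S.eq_one_minus[OF uv'(1-3)] u by (simp add: v_def a_minus_def)
  then have dvd: "h b divides\<^bsub>S\<^esub> h (u \<otimes> a)" "h a divides\<^bsub>S\<^esub> h (v \<otimes> b)"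
    using uv'(4,5) u v ab by simp_all
  obtain x where x: "x \<in> carrier R" "u \<otimes> a \<ominus> b \<otimes> x \<in> a_kernel R S h"
    using divides_of_image_divides[OF ab(2) _ dvd(1)] u ab by auto
  obtain y where y: "y \<in> carrier R" "v \<otimes> b \<ominus> a \<otimes> y \<in> a_kernel R S h"
    using divides_of_image_divides[OF ab(1) _ dvd(2)] v ab by auto
  have colon: "t \<otimes> c \<in> colon R d e"
    if "t \<in> carrier R" "c \<in> carrier R" "d \<in> carrier R" "e \<in> carrier R" "z \<in> carrier R"
      "t \<otimes> (c \<otimes> e \<ominus> d \<otimes> z) = \<zero>" for t c d e z
  proof -
    have "t \<otimes> (c \<otimes> e) \<ominus> t \<otimes> (d \<otimes> z) = \<zero>"
      using that by (simp add: a_minus_def R.r_distr R.r_minus)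
    then have "t \<otimes> (c \<otimes> e) = t \<otimes> (d \<otimes> z)" using that by (simp add: R.r_right_minus_eq)
    then have "(t \<otimes> c) \<otimes> e = d \<otimes> (t \<otimes> z)" using that by (simp add: R.m_assoc R.m_lcomm)
    then show ?thesis using that by (auto simp: colon_def factor_def)
  qed
  have "t \<in> comparison R a b"
    if t: "t \<in> carrier R" "t \<otimes> (u \<otimes> a \<ominus> b \<otimes> x) = \<zero>" "t \<otimes> (v \<otimes> b \<ominus> a \<otimes> y) = \<zero>" for t
  proof -
    have "t = t \<otimes> u \<oplus> t \<otimes> v"
      using t u R.r_distr[of u v t] v by (simp add: v_def R.add_one_minus)
    moreover have "t \<otimes> u \<in> colon R b a" "t \<otimes> v \<in> colon R a b"
      using colon t u v x y ab by blast+
    ultimately show ?thesis unfolding comparison_def set_add_def' by blast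
  qed
  then show thesis using that x y by blast
qed

end

section \<open>Subdirect products of two rings\<close>

text \<open>
  \<open>D\<close> embeds into \<open>R \<times> S\<close> and projects onto both factors. Keeping the two projections on an equal
  footing lets statements about one kernel be transferred to the other by \<open>swap\<close>.
\<close>

locale subdirect_product =
  p: surjective_ring_hom D R p + q: surjective_ring_hom D S q
  for D (structure) and R and S and p and q +
  assumes kernels_disjoint: "a_kernel D R p \<inter> a_kernel D S q = {\<zero>}"
begin

lemma swap: "subdirect_product D S R q p"
  by unfold_locales (use kernels_disjoint in blast)

lemma kernels_annihilate:
  assumes "k \<in> a_kernel D R p" "l \<in> a_kernel D S q"
  shows "k \<otimes> l = \<zero>"
proof -
  have "k \<otimes> l \<in> a_kernel D R p \<inter> a_kernel D S q"
    using assms by (auto simp: p.mem_kernel_iff q.mem_kernel_iff)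
  then show ?thesis by (simp add: kernels_disjoint)
qed

text \<open>
  The kernel of \<open>q\<close> annihilates the kernel of \<open>p\<close>, in particular the two errors arising from a
  comparison in \<open>R\<close>.
\<close>

lemma kernel_subset_comparison:
  assumes R: "arithmetical_ring R" and ab: "a \<in> carrier D" "b \<in> carrier D"
  shows "a_kernel D S q \<subseteq> comparison D a b"
proof
  fix l assume l: "l \<in> a_kernel D S q"
  obtain w w' where "w \<in> a_kernel D R p" "w' \<in> a_kernel D R p"
    "\<And>t. t \<in> carrier D \<Longrightarrow> t \<otimes> w = \<zero> \<Longrightarrow> t \<otimes> w' = \<zero> \<Longrightarrow> t \<in> comparison D a b"
    using p.comparison_of_kernel_annihilator[OF R ab] by metis
  moreover have "l \<otimes> w = \<zero>" if "w \<in> a_kernel D R p" for w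
    using kernels_annihilate[OF that l] that l p.R.m_comm[of l w]
    by (simp add: p.mem_kernel_iff q.mem_kernel_iff)
  ultimately show "l \<in> comparison D a b" using l by (simp add: q.mem_kernel_iff)
qed

text \<open>
  A multiple of an element of one kernel that lies in the other kernel is zero.
\<close>

lemma chained_imp_kernel_trivial:
  assumes "chained_ring D"
  shows "a_kernel D R p = {\<zero>} \<or> a_kernel D S q = {\<zero>}"
proof -
  have zero: "k = \<zero>" if "k \<in> a_kernel D R p" "l \<in> a_kernel D S q" "l divides k" for k l
  proof -
    have "k \<in> a_kernel D S q"
      using that by (auto simp: factor_def p.mem_kernel_iff q.mem_kernel_iff)
    then show ?thesis using that(1) kernels_disjoint by blast
  qed
  have zero': "l = \<zero>" if "k \<in> a_kernel D R p" "l \<in> a_kernel D S q" "k divides l" for k l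
  proof -
    have "l \<in> a_kernel D R p"
      using that by (auto simp: factor_def p.mem_kernel_iff q.mem_kernel_iff)
    then show ?thesis using that(2) kernels_disjoint by blast
  qed
  have "k = \<zero> \<or> l = \<zero>" if kl: "k \<in> a_kernel D R p" "l \<in> a_kernel D S q" for k l
  proof -
    have "k divides l \<or> l divides k"
      using assms kl
      by (simp add: chained_ring_iff_divides_total p.mem_kernel_iff q.mem_kernel_iff)
    then show ?thesis using zero zero' kl by blast
  qed
  moreover have "\<zero> \<in> a_kernel D R p" "\<zero> \<in> a_kernel D S q"
    using kernels_disjoint by auto
  ultimately show ?thesis by blast
qed

text \<open>
  If one kernel is trivial, then \<open>D\<close> is isomorphic to the corresponding factor.
\<close>

theorem chained_iff:
  assumes "\<one>\<^bsub>R\<^esub> \<noteq> \<zero>\<^bsub>R\<^esub>" "\<one>\<^bsub>S\<^esub> \<noteq> \<zero>\<^bsub>S\<^esub>"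
  shows "chained_ring D \<longleftrightarrow> chained_ring R \<and> chained_ring S \<and>
    (a_kernel D R p = {\<zero>} \<or> a_kernel D S q = {\<zero>})"
  using assms p.chained_image q.chained_image chained_imp_kernel_trivial
    p.chained_of_trivial_kernel q.chained_of_trivial_kernel by metis

text \<open>
  The two errors of a lifted comparison have annihilators \<open>t\<close> and \<open>t'\<close> in \<open>T\<close>; their product
  annihilates both.
\<close>

lemma comparison_meets_annihilating_set:
  assumes R: "arithmetical_ring R" and ab: "a \<in> carrier D" "b \<in> carrier D"
    and T: "mult_subset D T" and ann: "\<And>k. k \<in> a_kernel D R p \<Longrightarrow> \<exists>t\<in>T. t \<otimes> k = \<zero>"
  shows "T \<inter> comparison D a b \<noteq> {}"
proof -
  interpret T: mult_subset D T by fact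
  obtain w w' where w: "w \<in> a_kernel D R p" "w' \<in> a_kernel D R p"
    and mem: "\<And>t. t \<in> carrier D \<Longrightarrow> t \<otimes> w = \<zero> \<Longrightarrow> t \<otimes> w' = \<zero> \<Longrightarrow> t \<in> comparison D a b"
    using p.comparison_of_kernel_annihilator[OF R ab] by metis
  obtain t where t: "t \<in> T" "t \<otimes> w = \<zero>" using ann[OF w(1)] by blast
  obtain t' where t': "t' \<in> T" "t' \<otimes> w' = \<zero>" using ann[OF w(2)] by blast
  have c: "t \<in> carrier D" "t' \<in> carrier D" "w \<in> carrier D" "w' \<in> carrier D"
    using t t' w T.S_carr by (auto simp: p.mem_kernel_iff)
  have "t \<otimes> t' \<otimes> w = t' \<otimes> (t \<otimes> w)" "t \<otimes> t' \<otimes> w' = t \<otimes> (t' \<otimes> w')"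
    using c by (simp_all add: p.R.m_ac)
  then have "t \<otimes> t' \<in> comparison D a b" using c t t' by (intro mem) auto
  then show ?thesis using T.m_closed[OF t(1) t'(1)] by blast
qed

text \<open>
  The local condition refers to maximal ideals of a ring \<open>A\<close> that covers \<open>D\<close> up to the sum \<open>K\<close> of the
  kernels. Writing \<open>u = h c + x\<close> with \<open>x \<in> K\<close> transports statements about elements of \<open>D\<close> outside a
  maximal ideal containing \<open>K\<close> to elements of \<open>A\<close> outside its preimage, without describing the
  maximal ideals of \<open>D\<close>. In the converse direction this works because \<open>K\<close> lies in every comparison
  ideal once \<open>R\<close> and \<open>S\<close> are arithmetical.
\<close>

theorem arithmetical_iff:
  assumes A: "cring A" and h: "h \<in> ring_hom A D"
    and K: "K = a_kernel D R p <+>\<^bsub>D\<^esub> a_kernel D S q"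
    and gen: "carrier D = h ` carrier A <+>\<^bsub>D\<^esub> K"
  shows "arithmetical_ring D \<longleftrightarrow> arithmetical_ring R \<and> arithmetical_ring S \<and>
    (\<forall>M\<in>Max_containing A {a \<in> carrier A. h a \<in> K}.
      (\<forall>k\<in>a_kernel D R p. \<exists>t\<in>S_at A D h K M. t \<otimes> k = \<zero>) \<or>
      (\<forall>k\<in>a_kernel D S q. \<exists>t\<in>S_at A D h K M. t \<otimes> k = \<zero>))"
proof -
  interpret A: cring A by fact
  interpret h: ring_hom_cring A D h by unfold_locales fact
  interpret kp: ideal "a_kernel D R p" D by (rule p.ring.kernel_is_ideal)
  interpret kq: ideal "a_kernel D S q" D by (rule q.ring.kernel_is_ideal)
  interpret K: ideal K D unfolding K by (intro p.R.add_ideals kp.is_ideal kq.is_ideal)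
  have T: "mult_subset D (S_at A D h K M)" if "maximalideal M A" for M
    using that by (intro mult_subset_S_at A p.R.is_cring h K.is_ideal A.maximalideal_prime)
  show ?thesis
  proof (intro iffI conjI ballI)
    assume D: "arithmetical_ring D"
    show "arithmetical_ring R" "arithmetical_ring S"
      using D by (rule p.arithmetical_image, rule q.arithmetical_image)
    fix M assume "M \<in> Max_containing A {a \<in> carrier A. h a \<in> K}"
    then have M: "maximalideal M A" by (simp add: Max_containing_def)
    interpret M: primeideal M A by (rule A.maximalideal_prime[OF M])
    have "(\<exists>t\<in>S_at A D h K M. t \<otimes> k = \<zero>) \<or> (\<exists>t\<in>S_at A D h K M. t \<otimes> l = \<zero>)"
      if k: "k \<in> a_kernel D R p" and l: "l \<in> a_kernel D S q" for k l
    proof -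
      have "\<one> \<in> comparison D k l"
        using D k l kp.Icarr kq.Icarr by (simp add: arithmetical_ring_iff_comparable)
      then obtain u v where uv: "u \<in> carrier D" "v \<in> carrier D" "\<one> = u \<oplus> v"
          "l divides u \<otimes> k" "k divides v \<otimes> l"
        unfolding comparison_iff by blast
      \<comment> \<open>Being multiples of both \<open>k\<close> and \<open>l\<close>, these products lie in both kernels.\<close>
      have "u \<otimes> k \<in> a_kernel D R p" "v \<otimes> l \<in> a_kernel D S q"
        using uv k l kp.I_l_closed kq.I_l_closed by auto
      moreover have "u \<otimes> k \<in> a_kernel D S q" "v \<otimes> l \<in> a_kernel D R p"
        using uv(4,5) k l kp.I_r_closed kq.I_r_closed by (auto simp: factor_def)
      ultimately have "u \<otimes> k = \<zero>" "v \<otimes> l = \<zero>" using kernels_disjoint by auto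
      moreover have "u \<in> S_at A D h K M \<or> v \<in> S_at A D h K M"
      proof -
        obtain c x where c: "c \<in> carrier A" "x \<in> K" "u = h c \<oplus> x"
          using uv(1) unfolding gen set_add_def' by blast
        have "v = \<one> \<ominus> u" using uv(1-3) by (rule p.R.eq_one_minus)
        also have "\<dots> = h (\<one>\<^bsub>A\<^esub> \<ominus>\<^bsub>A\<^esub> c) \<oplus> \<ominus> x"
          using c K.Icarr by (simp add: a_minus_def p.R.minus_add p.R.a_assoc)
        finally have v: "v = h (\<one>\<^bsub>A\<^esub> \<ominus>\<^bsub>A\<^esub> c) \<oplus> \<ominus> x" .
        have "c \<in> carrier A - M \<or> \<one>\<^bsub>A\<^esub> \<ominus>\<^bsub>A\<^esub> c \<in> carrier A - M"
          using c by (intro M.in_compl_of_sum_one) (simp_all add: A.add_one_minus)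
        then show ?thesis
          unfolding S_at_def set_add_def' using c v K.a_inv_closed[OF c(2)] by blast
      qed
      ultimately show ?thesis by blast
    qed
    then show "(\<forall>k\<in>a_kernel D R p. \<exists>t\<in>S_at A D h K M. t \<otimes> k = \<zero>) \<or>
        (\<forall>k\<in>a_kernel D S q. \<exists>t\<in>S_at A D h K M. t \<otimes> k = \<zero>)" by blast
  next
    assume *: "arithmetical_ring R \<and> arithmetical_ring S \<and>
      (\<forall>M\<in>Max_containing A {a \<in> carrier A. h a \<in> K}.
        (\<forall>k\<in>a_kernel D R p. \<exists>t\<in>S_at A D h K M. t \<otimes> k = \<zero>) \<or>
        (\<forall>k\<in>a_kernel D S q. \<exists>t\<in>S_at A D h K M. t \<otimes> k = \<zero>))"
    have "\<one> \<in> comparison D a b" if ab: "a \<in> carrier D" "b \<in> carrier D" for a b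
    proof (rule ccontr)
      assume notin: "\<one> \<notin> comparison D a b"
      interpret N: ideal "comparison D a b" D using ab by (rule p.R.comparison_ideal)
      interpret swap: subdirect_product D S R q p by (rule swap)
      have "a_kernel D R p \<subseteq> comparison D a b" "a_kernel D S q \<subseteq> comparison D a b"
        using * ab by (auto dest: subsetD[OF kernel_subset_comparison] subsetD[OF swap.kernel_subset_comparison])
      then have K_sub: "K \<subseteq> comparison D a b"
        unfolding K set_add_def' using N.a_closed by blast
      \<comment> \<open>A maximal ideal above this preimage also contains the preimage of \<open>K\<close>,
        so that the local hypothesis applies to it.\<close>
      let ?N = "{c \<in> carrier A. h c \<in> comparison D a b}"
      have "ideal ?N A" by (rule h.ring.ideal_vimage[OF N.is_ideal])
      moreover have "?N \<noteq> carrier A" using notin h.hom_one A.one_closed by force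
      ultimately obtain M where M: "maximalideal M A" "?N \<subseteq> M"
        using A.exists_maximalideal by blast
      have "M \<in> Max_containing A {c \<in> carrier A. h c \<in> K}"
        using M K_sub by (auto simp: Max_containing_def)
      then have "S_at A D h K M \<inter> comparison D a b \<noteq> {}"
        using * comparison_meets_annihilating_set[OF _ ab T[OF M(1)]]
          swap.comparison_meets_annihilating_set[OF _ ab T[OF M(1)]] by blast
      then obtain s x where s: "s \<in> carrier A - M" "x \<in> K" "h s \<oplus> x \<in> comparison D a b"
        unfolding S_at_def set_add_def' by blast
      \<comment> \<open>Subtracting \<open>x \<in> K\<close> puts \<open>s\<close> into the preimage, which \<open>M\<close> contains.\<close>
      have "(h s \<oplus> x) \<ominus> x \<in> comparison D a b"
        unfolding a_minus_def using K_sub s(2) by (intro N.a_closed[OF s(3)] N.a_inv_closed) auto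
      also have "(h s \<oplus> x) \<ominus> x = h s"
        using s(1) K.Icarr[OF s(2)] by (simp add: a_minus_def p.R.a_assoc p.R.r_neg)
      finally have "h s \<in> comparison D a b" .
      then show False using s M(2) by blast
    qed
    then show "arithmetical_ring D"
      using p.R.is_cring by (simp add: arithmetical_ring_iff_comparable)
  qed
qed

end

section \<open>Bi-amalgamations\<close>

lemma RDirProd_simps:
  "x \<otimes>\<^bsub>RDirProd B C\<^esub> y = (fst x \<otimes>\<^bsub>B\<^esub> fst y, snd x \<otimes>\<^bsub>C\<^esub> snd y)"
  "x \<oplus>\<^bsub>RDirProd B C\<^esub> y = (fst x \<oplus>\<^bsub>B\<^esub> fst y, snd x \<oplus>\<^bsub>C\<^esub> snd y)"
  "\<one>\<^bsub>RDirProd B C\<^esub> = (\<one>\<^bsub>B\<^esub>, \<one>\<^bsub>C\<^esub>)"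
  "\<zero>\<^bsub>RDirProd B C\<^esub> = (\<zero>\<^bsub>B\<^esub>, \<zero>\<^bsub>C\<^esub>)"
  by (simp_all add: RDirProd_def DirProd_def monoid.defs split_beta)

text \<open>
  The last assumption is the equality of the preimages \<open>f\<inverse>(J)\<close> and \<open>g\<inverse>(J')\<close>; it is what makes the
  kernels of the projections no larger than \<open>0 \<times> J'\<close> and \<open>J \<times> 0\<close>.
\<close>

locale bi_amalgam =
  f: ring_hom_cring A B f + g: ring_hom_cring A C g + J: ideal J B + J': ideal J' C
  for A and B and C and f and g and J and J' +
  assumes preimages: "\<And>a. a \<in> carrier A \<Longrightarrow> f a \<in> J \<longleftrightarrow> g a \<in> J'"
begin

abbreviation "D \<equiv> bi_amalgamation A B C f g J J'"

abbreviation "R \<equiv> image_plus_ideal A B f J"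

abbreviation "S \<equiv> image_plus_ideal A C g J'"

lemma D_simps [simp]:
  "x \<otimes>\<^bsub>D\<^esub> y = (fst x \<otimes>\<^bsub>B\<^esub> fst y, snd x \<otimes>\<^bsub>C\<^esub> snd y)"
  "x \<oplus>\<^bsub>D\<^esub> y = (fst x \<oplus>\<^bsub>B\<^esub> fst y, snd x \<oplus>\<^bsub>C\<^esub> snd y)"
  "\<one>\<^bsub>D\<^esub> = (\<one>\<^bsub>B\<^esub>, \<one>\<^bsub>C\<^esub>)"
  "\<zero>\<^bsub>D\<^esub> = (\<zero>\<^bsub>B\<^esub>, \<zero>\<^bsub>C\<^esub>)"
  by (simp_all add: bi_amalgamation_def RDirProd_simps)

lemma RS_simps [simp]:
  "x \<otimes>\<^bsub>R\<^esub> y = x \<otimes>\<^bsub>B\<^esub> y" "x \<oplus>\<^bsub>R\<^esub> y = x \<oplus>\<^bsub>B\<^esub> y" "\<one>\<^bsub>R\<^esub> = \<one>\<^bsub>B\<^esub>" "\<zero>\<^bsub>R\<^esub> = \<zero>\<^bsub>B\<^esub>"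
  "x' \<otimes>\<^bsub>S\<^esub> y' = x' \<otimes>\<^bsub>C\<^esub> y'" "x' \<oplus>\<^bsub>S\<^esub> y' = x' \<oplus>\<^bsub>C\<^esub> y'" "\<one>\<^bsub>S\<^esub> = \<one>\<^bsub>C\<^esub>" "\<zero>\<^bsub>S\<^esub> = \<zero>\<^bsub>C\<^esub>"
  by (simp_all add: image_plus_ideal_def)

lemma carrier_D:
  "carrier D = {(f a \<oplus>\<^bsub>B\<^esub> j, g a \<oplus>\<^bsub>C\<^esub> j') | a j j'. a \<in> carrier A \<and> j \<in> J \<and> j' \<in> J'}"
  by (simp add: bi_amalgamation_def)

lemma carrier_RS:
  "carrier R = {f a \<oplus>\<^bsub>B\<^esub> j | a j. a \<in> carrier A \<and> j \<in> J}"
  "carrier S = {g a \<oplus>\<^bsub>C\<^esub> j' | a j'. a \<in> carrier A \<and> j' \<in> J'}"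
  by (auto simp: image_plus_ideal_def set_add_def')

lemma carrier_DI:
  "a \<in> carrier A \<Longrightarrow> j \<in> J \<Longrightarrow> j' \<in> J' \<Longrightarrow> (f a \<oplus>\<^bsub>B\<^esub> j, g a \<oplus>\<^bsub>C\<^esub> j') \<in> carrier D"
  by (auto simp: carrier_D)

lemma cring_R: "cring R" and cring_S: "cring S"
proof -
  have B: "subcring (f ` carrier A <+>\<^bsub>B\<^esub> J) B"
    by (intro subcring_image_plus_ideal f.R.is_cring f.S.is_cring f.homh J.is_ideal)
  then show "cring R"
    using f.S.subcring_iff[OF subcringE(1)[OF B]] by (simp add: image_plus_ideal_def)
  have C: "subcring (g ` carrier A <+>\<^bsub>C\<^esub> J') C"
    by (intro subcring_image_plus_ideal f.R.is_cring g.S.is_cring g.homh J'.is_ideal)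
  then show "cring S"
    using g.S.subcring_iff[OF subcringE(1)[OF C]] by (simp add: image_plus_ideal_def)
qed

lemma cring_D: "cring D"
proof -
  interpret P: ring "RDirProd B C" by (intro RDirProd_ring f.S.ring_axioms g.S.ring_axioms)
  have sub: "carrier D \<subseteq> carrier (RDirProd B C)"
    by (auto simp: carrier_D RDirProd_carrier)
  have "subring (carrier D) (RDirProd B C)"
  proof (rule P.subringI[OF sub])
    show "\<one>\<^bsub>RDirProd B C\<^esub> \<in> carrier D"
      using carrier_DI[of "\<one>\<^bsub>A\<^esub>" "\<zero>\<^bsub>B\<^esub>" "\<zero>\<^bsub>C\<^esub>"] by (simp add: RDirProd_simps)
  next
    fix x assume "x \<in> carrier D"
    then obtain a j j' where x: "a \<in> carrier A" "j \<in> J" "j' \<in> J'"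
      "x = (f a \<oplus>\<^bsub>B\<^esub> j, g a \<oplus>\<^bsub>C\<^esub> j')" by (auto simp: carrier_D)
    define y where "y = (f (\<ominus>\<^bsub>A\<^esub> a) \<oplus>\<^bsub>B\<^esub> \<ominus>\<^bsub>B\<^esub> j, g (\<ominus>\<^bsub>A\<^esub> a) \<oplus>\<^bsub>C\<^esub> \<ominus>\<^bsub>C\<^esub> j')"
    have y: "y \<in> carrier D"
      unfolding y_def using x by (intro carrier_DI) auto
    have "y \<oplus>\<^bsub>RDirProd B C\<^esub> x = \<zero>\<^bsub>RDirProd B C\<^esub>"
      using x J.Icarr J'.Icarr
      by (simp add: y_def RDirProd_simps f.S.minus_add[symmetric] g.S.minus_add[symmetric] f.S.l_neg g.S.l_neg)
    then have "\<ominus>\<^bsub>RDirProd B C\<^esub> x = y"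
      using x(4) y sub carrier_DI[OF x(1-3)] by (intro P.minus_equality) auto
    then show "\<ominus>\<^bsub>RDirProd B C\<^esub> x \<in> carrier D" using y by simp
  next
    fix x y assume "x \<in> carrier D" "y \<in> carrier D"
    then obtain a j j' b i i' where x: "a \<in> carrier A" "j \<in> J" "j' \<in> J'"
        "x = (f a \<oplus>\<^bsub>B\<^esub> j, g a \<oplus>\<^bsub>C\<^esub> j')"
      and y: "b \<in> carrier A" "i \<in> J" "i' \<in> J'" "y = (f b \<oplus>\<^bsub>B\<^esub> i, g b \<oplus>\<^bsub>C\<^esub> i')"
      unfolding carrier_D by blast
    have "x \<oplus>\<^bsub>RDirProd B C\<^esub> y = (f (a \<oplus>\<^bsub>A\<^esub> b) \<oplus>\<^bsub>B\<^esub> (j \<oplus>\<^bsub>B\<^esub> i), g (a \<oplus>\<^bsub>A\<^esub> b) \<oplus>\<^bsub>C\<^esub> (j' \<oplus>\<^bsub>C\<^esub> i'))"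
      using x y J.Icarr J'.Icarr by (simp add: RDirProd_simps f.S.a_ac g.S.a_ac)
    also have "\<dots> \<in> carrier D" using x y by (intro carrier_DI) auto
    finally show "x \<oplus>\<^bsub>RDirProd B C\<^esub> y \<in> carrier D" .
    obtain l where l: "l \<in> J" "(f a \<oplus>\<^bsub>B\<^esub> j) \<otimes>\<^bsub>B\<^esub> (f b \<oplus>\<^bsub>B\<^esub> i) = f a \<otimes>\<^bsub>B\<^esub> f b \<oplus>\<^bsub>B\<^esub> l"
      using sum_ideal_mult[OF f.S.is_cring J.is_ideal, of "f a" "f b" j i] x y by auto
    obtain l' where l': "l' \<in> J'" "(g a \<oplus>\<^bsub>C\<^esub> j') \<otimes>\<^bsub>C\<^esub> (g b \<oplus>\<^bsub>C\<^esub> i') = g a \<otimes>\<^bsub>C\<^esub> g b \<oplus>\<^bsub>C\<^esub> l'"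
      using sum_ideal_mult[OF g.S.is_cring J'.is_ideal, of "g a" "g b" j' i'] x y by auto
    have "x \<otimes>\<^bsub>RDirProd B C\<^esub> y = (f (a \<otimes>\<^bsub>A\<^esub> b) \<oplus>\<^bsub>B\<^esub> l, g (a \<otimes>\<^bsub>A\<^esub> b) \<oplus>\<^bsub>C\<^esub> l')"
      using x y l l' by (simp add: RDirProd_simps)
    also have "\<dots> \<in> carrier D" using x y l l' by (intro carrier_DI) auto
    finally show "x \<otimes>\<^bsub>RDirProd B C\<^esub> y \<in> carrier D" .
  qed
  then have "subcring (carrier D) (RDirProd B C)"
    using subsetD[OF sub]
    by (intro P.subcringI) (auto simp: RDirProd_simps RDirProd_carrier f.S.m_comm g.S.m_comm mem_Times_iff)
  then show ?thesis
    using P.subcring_iff[OF sub] by (simp add: bi_amalgamation_def)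
qed

lemma kernel_fst: "a_kernel D R fst = {\<zero>\<^bsub>B\<^esub>} \<times> J'"
proof
  show "a_kernel D R fst \<subseteq> {\<zero>\<^bsub>B\<^esub>} \<times> J'"
  proof
    fix x assume "x \<in> a_kernel D R fst"
    then have "x \<in> carrier D" and fst: "fst x = \<zero>\<^bsub>B\<^esub>" by (simp_all add: a_kernel_def')
    then obtain a j j' where x: "a \<in> carrier A" "j \<in> J" "j' \<in> J'"
      "x = (f a \<oplus>\<^bsub>B\<^esub> j, g a \<oplus>\<^bsub>C\<^esub> j')"
      unfolding carrier_D by blast
    then have zero: "f a \<oplus>\<^bsub>B\<^esub> j = \<zero>\<^bsub>B\<^esub>" using fst by simp
    have "f a = \<ominus>\<^bsub>B\<^esub> j" using zero x J.Icarr by (intro f.S.sum_zero_eq_neg) auto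
    then have "g a \<in> J'" using J.a_inv_closed[OF x(2)] preimages[OF x(1)] by simp
    then show "x \<in> {\<zero>\<^bsub>B\<^esub>} \<times> J'" using x zero by simp
  qed
  have "(\<zero>\<^bsub>B\<^esub>, j') \<in> carrier D" if "j' \<in> J'" for j'
    using carrier_DI[of "\<zero>\<^bsub>A\<^esub>" "\<zero>\<^bsub>B\<^esub>" j'] that J'.Icarr by simp
  then show "{\<zero>\<^bsub>B\<^esub>} \<times> J' \<subseteq> a_kernel D R fst"
    by (auto simp: a_kernel_def')
qed

lemma kernel_snd: "a_kernel D S snd = J \<times> {\<zero>\<^bsub>C\<^esub>}"
proof
  show "a_kernel D S snd \<subseteq> J \<times> {\<zero>\<^bsub>C\<^esub>}"
  proof
    fix x assume "x \<in> a_kernel D S snd"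
    then have "x \<in> carrier D" and snd: "snd x = \<zero>\<^bsub>C\<^esub>" by (simp_all add: a_kernel_def')
    then obtain a j j' where x: "a \<in> carrier A" "j \<in> J" "j' \<in> J'"
      "x = (f a \<oplus>\<^bsub>B\<^esub> j, g a \<oplus>\<^bsub>C\<^esub> j')"
      unfolding carrier_D by blast
    then have zero: "g a \<oplus>\<^bsub>C\<^esub> j' = \<zero>\<^bsub>C\<^esub>" using snd by simp
    have "g a = \<ominus>\<^bsub>C\<^esub> j'" using zero x J'.Icarr by (intro g.S.sum_zero_eq_neg) auto
    then have "f a \<in> J" using J'.a_inv_closed[OF x(3)] preimages[OF x(1)] by simp
    then show "x \<in> J \<times> {\<zero>\<^bsub>C\<^esub>}" using x zero by simp
  qed
  have "(j, \<zero>\<^bsub>C\<^esub>) \<in> carrier D" if "j \<in> J" for j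
    using carrier_DI[of "\<zero>\<^bsub>A\<^esub>" j "\<zero>\<^bsub>C\<^esub>"] that J.Icarr by simp
  then show "J \<times> {\<zero>\<^bsub>C\<^esub>} \<subseteq> a_kernel D S snd"
    by (auto simp: a_kernel_def')
qed

lemma subdirect: "subdirect_product D R S fst snd"
proof -
  interpret D: cring D by (rule cring_D)
  interpret R: cring R by (rule cring_R)
  interpret S: cring S by (rule cring_S)
  have "fst ` carrier D = carrier R"
  proof -
    have "f a \<oplus>\<^bsub>B\<^esub> j \<in> fst ` carrier D" if "a \<in> carrier A" "j \<in> J" for a j
      using carrier_DI[OF that J'.zero_closed] by force
    then have "carrier R \<subseteq> fst ` carrier D" unfolding carrier_RS by blast
    moreover have "fst ` carrier D \<subseteq> carrier R" unfolding carrier_D carrier_RS by (clarsimp, blast)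
    ultimately show ?thesis by simp
  qed
  moreover have "snd ` carrier D = carrier S"
  proof -
    have "g a \<oplus>\<^bsub>C\<^esub> j' \<in> snd ` carrier D" if "a \<in> carrier A" "j' \<in> J'" for a j'
      using carrier_DI[OF that(1) J.zero_closed that(2)] by force
    then have "carrier S \<subseteq> snd ` carrier D" unfolding carrier_RS by blast
    moreover have "snd ` carrier D \<subseteq> carrier S" unfolding carrier_D carrier_RS by (clarsimp, blast)
    ultimately show ?thesis by simp
  qed
  moreover from calculation have "fst \<in> ring_hom D R" "snd \<in> ring_hom D S"
    by (auto intro!: ring_hom_memI)
  moreover have "a_kernel D R fst \<inter> a_kernel D S snd = {\<zero>\<^bsub>D\<^esub>}"
    using J.zero_closed J'.zero_closed by (auto simp: kernel_fst kernel_snd)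
  ultimately show ?thesis by unfold_locales
qed

lemma diagonal_hom: "(\<lambda>a. (f a, g a)) \<in> ring_hom A D"
proof (rule ring_hom_memI)
  show "(f a, g a) \<in> carrier D" if "a \<in> carrier A" for a
    using carrier_DI[OF that J.zero_closed J'.zero_closed] that by simp
qed auto

lemma kernel_sum: "a_kernel D R fst <+>\<^bsub>D\<^esub> a_kernel D S snd = J \<times> J'"
  using J.Icarr J'.Icarr by (force simp: set_add_def' kernel_fst kernel_snd)

lemma S_at_D:
  "S_at A D (\<lambda>a. (f a, g a)) (J \<times> J') M =
    {(f s \<oplus>\<^bsub>B\<^esub> j, g s \<oplus>\<^bsub>C\<^esub> j') | s j j'. s \<in> carrier A - M \<and> j \<in> J \<and> j' \<in> J'}"
  by (force simp: S_at_def set_add_def')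

text \<open>
  The set of denominators in \<open>D\<close> projects onto the sets \<open>S\<^sub>M\<close> and \<open>S'\<^sub>M\<close>. Since an element of
  one of the kernels has only one nonzero component, annihilating it in \<open>D\<close> means annihilating that
  component by a projected denominator.
\<close>

lemma S_at_projections:
  "fst ` S_at A D (\<lambda>a. (f a, g a)) (J \<times> J') M = S_at A B f J M"
  "snd ` S_at A D (\<lambda>a. (f a, g a)) (J \<times> J') M = S_at A C g J' M"
proof -
  have B: "S_at A B f J M = {f s \<oplus>\<^bsub>B\<^esub> j | s j. s \<in> carrier A - M \<and> j \<in> J}"
    and C: "S_at A C g J' M = {g s \<oplus>\<^bsub>C\<^esub> j' | s j'. s \<in> carrier A - M \<and> j' \<in> J'}"
    by (auto simp: S_at_def set_add_def')
  have mem: "(f s \<oplus>\<^bsub>B\<^esub> j, g s \<oplus>\<^bsub>C\<^esub> j') \<in> S_at A D (\<lambda>a. (f a, g a)) (J \<times> J') M"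
    if "s \<in> carrier A - M" "j \<in> J" "j' \<in> J'" for s j j'
    unfolding S_at_D using that by blast
  have "f s \<oplus>\<^bsub>B\<^esub> j \<in> fst ` S_at A D (\<lambda>a. (f a, g a)) (J \<times> J') M" if "s \<in> carrier A - M" "j \<in> J" for s j
    using imageI[OF mem[OF that J'.zero_closed], of fst] by simp
  moreover have "fst ` S_at A D (\<lambda>a. (f a, g a)) (J \<times> J') M \<subseteq> S_at A B f J M"
    unfolding S_at_D B by (clarsimp, blast)
  ultimately show "fst ` S_at A D (\<lambda>a. (f a, g a)) (J \<times> J') M = S_at A B f J M"
    unfolding B by blast
  have "g s \<oplus>\<^bsub>C\<^esub> j' \<in> snd ` S_at A D (\<lambda>a. (f a, g a)) (J \<times> J') M" if "s \<in> carrier A - M" "j' \<in> J'" for s j'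
    using imageI[OF mem[OF that(1) J.zero_closed that(2)], of snd] by simp
  moreover have "snd ` S_at A D (\<lambda>a. (f a, g a)) (J \<times> J') M \<subseteq> S_at A C g J' M"
    unfolding S_at_D C by (clarsimp, blast)
  ultimately show "snd ` S_at A D (\<lambda>a. (f a, g a)) (J \<times> J') M = S_at A C g J' M"
    unfolding C by blast
qed

lemma S_at_D_carrier: "t \<in> S_at A D (\<lambda>a. (f a, g a)) (J \<times> J') M \<Longrightarrow> fst t \<in> carrier B \<and> snd t \<in> carrier C"
  unfolding S_at_D using J.Icarr J'.Icarr by clarsimp

lemma annihilated_fst_iff:
  "(\<forall>k\<in>a_kernel D R fst. \<exists>t\<in>S_at A D (\<lambda>a. (f a, g a)) (J \<times> J') M. t \<otimes>\<^bsub>D\<^esub> k = \<zero>\<^bsub>D\<^esub>) \<longleftrightarrow>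
    (\<forall>x\<in>J'. \<exists>t\<in>S_at A C g J' M. t \<otimes>\<^bsub>C\<^esub> x = \<zero>\<^bsub>C\<^esub>)"
  unfolding S_at_projections(2)[symmetric] kernel_fst
  using S_at_D_carrier by (simp cong: bex_cong)

lemma annihilated_snd_iff:
  "(\<forall>k\<in>a_kernel D S snd. \<exists>t\<in>S_at A D (\<lambda>a. (f a, g a)) (J \<times> J') M. t \<otimes>\<^bsub>D\<^esub> k = \<zero>\<^bsub>D\<^esub>) \<longleftrightarrow>
    (\<forall>x\<in>J. \<exists>t\<in>S_at A B f J M. t \<otimes>\<^bsub>B\<^esub> x = \<zero>\<^bsub>B\<^esub>)"
  unfolding S_at_projections(1)[symmetric] kernel_snd
  using S_at_D_carrier by (simp cong: bex_cong)

lemma chained_iff: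
  assumes "J \<noteq> carrier B" "J' \<noteq> carrier C"
  shows "chained_ring D \<longleftrightarrow> chained_ring R \<and> chained_ring S \<and> (J = {\<zero>\<^bsub>B\<^esub>} \<or> J' = {\<zero>\<^bsub>C\<^esub>})"
proof -
  interpret subdirect_product D R S fst snd by (rule subdirect)
  have "\<one>\<^bsub>B\<^esub> \<noteq> \<zero>\<^bsub>B\<^esub>" "\<one>\<^bsub>C\<^esub> \<noteq> \<zero>\<^bsub>C\<^esub>"
    using assms J.one_imp_carrier J.zero_closed J'.one_imp_carrier J'.zero_closed by metis+
  moreover have "a_kernel D R fst = {\<zero>\<^bsub>D\<^esub>} \<longleftrightarrow> J' = {\<zero>\<^bsub>C\<^esub>}"
    "a_kernel D S snd = {\<zero>\<^bsub>D\<^esub>} \<longleftrightarrow> J = {\<zero>\<^bsub>B\<^esub>}"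
    using J.zero_closed J'.zero_closed by (auto simp: kernel_fst kernel_snd)
  ultimately show ?thesis using chained_iff by auto
qed

lemma arithmetical_iff:
  "arithmetical_ring D \<longleftrightarrow> arithmetical_ring R \<and> arithmetical_ring S \<and>
    (\<forall>M\<in>Max_containing A {a \<in> carrier A. f a \<in> J}.
      loc_ideal B (S_at A B f J M) J = {\<zero>\<^bsub>localization B (S_at A B f J M)\<^esub>} \<or>
      loc_ideal C (S_at A C g J' M) J' = {\<zero>\<^bsub>localization C (S_at A C g J' M)\<^esub>})"
proof -
  interpret subdirect_product D R S fst snd by (rule subdirect)
  have "carrier D = (\<lambda>a. (f a, g a)) ` carrier A <+>\<^bsub>D\<^esub> J \<times> J'"
    unfolding carrier_D set_add_def' by force
  note iff = arithmetical_iff[OF f.R.is_cring diagonal_hom kernel_sum[symmetric] this]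
  have "{a \<in> carrier A. (f a, g a) \<in> J \<times> J'} = {a \<in> carrier A. f a \<in> J}"
    using preimages by auto
  moreover have
    "loc_ideal B (S_at A B f J M) J = {\<zero>\<^bsub>localization B (S_at A B f J M)\<^esub>} \<longleftrightarrow>
      (\<forall>x\<in>J. \<exists>t\<in>S_at A B f J M. t \<otimes>\<^bsub>B\<^esub> x = \<zero>\<^bsub>B\<^esub>)"
    "loc_ideal C (S_at A C g J' M) J' = {\<zero>\<^bsub>localization C (S_at A C g J' M)\<^esub>} \<longleftrightarrow>
      (\<forall>x\<in>J'. \<exists>t\<in>S_at A C g J' M. t \<otimes>\<^bsub>C\<^esub> x = \<zero>\<^bsub>C\<^esub>)"
    if "M \<in> Max_containing A {a \<in> carrier A. f a \<in> J}" for M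
  proof -
    have M: "primeideal M A"
      using that f.R.maximalideal_prime by (auto simp: Max_containing_def)
    show "loc_ideal B (S_at A B f J M) J = {\<zero>\<^bsub>localization B (S_at A B f J M)\<^esub>} \<longleftrightarrow>
        (\<forall>x\<in>J. \<exists>t\<in>S_at A B f J M. t \<otimes>\<^bsub>B\<^esub> x = \<zero>\<^bsub>B\<^esub>)"
      by (intro mult_subset.loc_ideal_zero_iff mult_subset_S_at f.R.is_cring f.S.is_cring
          f.homh J.is_ideal M)
    show "loc_ideal C (S_at A C g J' M) J' = {\<zero>\<^bsub>localization C (S_at A C g J' M)\<^esub>} \<longleftrightarrow>
        (\<forall>x\<in>J'. \<exists>t\<in>S_at A C g J' M. t \<otimes>\<^bsub>C\<^esub> x = \<zero>\<^bsub>C\<^esub>)"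
      by (intro mult_subset.loc_ideal_zero_iff mult_subset_S_at f.R.is_cring g.S.is_cring
          g.homh J'.is_ideal M)
  qed
  ultimately show ?thesis
    unfolding iff annihilated_fst_iff annihilated_snd_iff by auto
qed

end

theorem theorem2p1:
  fixes A :: "('a, 'm) ring_scheme" and B :: "('b, 'n) ring_scheme" and C :: "('c, 'o) ring_scheme"
    and f :: "'a \<Rightarrow> 'b" and g :: "'a \<Rightarrow> 'c" and J :: "'b set" and J' :: "'c set" and I\<^sub>o :: "'a set"
  assumes "cring A" and "cring B" and "cring C"
    and "f \<in> ring_hom A B" and "g \<in> ring_hom A C"
    and "ideal J B" and "J \<noteq> carrier B"
    and "ideal J' C" and "J' \<noteq> carrier C"
    and "I\<^sub>o = {a \<in> carrier A. f a \<in> J}" and "I\<^sub>o = {a \<in> carrier A. g a \<in> J'}"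
  shows "(chained_ring (bi_amalgamation A B C f g J J') \<longleftrightarrow>
      chained_ring (image_plus_ideal A B f J) \<and> chained_ring (image_plus_ideal A C g J') \<and>
      (J = {\<zero>\<^bsub>B\<^esub>} \<or> J' = {\<zero>\<^bsub>C\<^esub>})) \<and>
    (arithmetical_ring (bi_amalgamation A B C f g J J') \<longleftrightarrow>
      arithmetical_ring (image_plus_ideal A B f J) \<and> arithmetical_ring (image_plus_ideal A C g J') \<and>
      (\<forall>M \<in> Max_containing A I\<^sub>o.
        loc_ideal B (S_at A B f J M) J = {\<zero>\<^bsub>localization B (S_at A B f J M)\<^esub>} \<or>
        loc_ideal C (S_at A C g J' M) J' = {\<zero>\<^bsub>localization C (S_at A C g J' M)\<^esub>}))"
proof -
  interpret bi_amalgam A B C f g J J'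
  proof (intro bi_amalgam.intro ring_hom_cring.intro ring_hom_cring_axioms.intro bi_amalgam_axioms.intro)
    show "f a \<in> J \<longleftrightarrow> g a \<in> J'" if "a \<in> carrier A" for a
      using assms(10,11) that by blast
  qed fact+
  show ?thesis
    using chained_iff[OF assms(7,9)] arithmetical_iff unfolding assms(10) by blast
qed

end
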